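(* Let $p\in(0,1)$ be fixed (independent of $n$) and let $\alpha$ be a fixed real number. For almost all graphs $G$ in the Erdős–Rényi model $G_{n,p}$, the energy of the general Randić matrix $R_\alpha(G)$ satisfies $$\mathscr{E}(R_\alpha(G))=(1+o(1))\,p^{2\alpha}\cdot\frac{8}{3\pi}\sqrt{p(1-p)}\cdot n^{3/2+2\alpha}.$$
   Context: $G_{n,p}$ is the model of random simple graphs on vertex set $\{1,\dots,n\}$ in which each edge is present independently with probability $p$; $d_i$ is the degree of vertex $i$ in $G=(V,E)$. $R_\alpha(G)$ is the $n\times n$ matrix with $(i,j)$-entry $(d_id_j)^\alpha$ if $ij\in E$ and $0$ otherwise. The energy of a real symmetric matrix $A$ with eigenvalues $\lambda_1,\dots,\lambda_n$ is $\mathscr{E}(A)=\sum_{i=1}^n|\lambda_i|$. "Almost all" means with probability tending to $1$ as $n\to\infty$; thus "for almost all graphs, $\mathscr{E}=(1+o(1))g(n)$" means that for every $\varepsilon>0$, $\Pr(|\mathscr{E}/g(n)-1|>\varepsilon)\to0$ as $n\to\infty$. *)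

theory Defs
  imports
    "HOL-Probability.Product_PMF"
    "Jordan_Normal_Form.Char_Poly"
begin

definition vertex_pairs :: "nat \<Rightarrow> nat set set" where
  "vertex_pairs n = {e. e \<subseteq> {1..n} \<and> card e = 2}"

text \<open>A simple graph on the vertex set \<open>{1..n}\<close> is represented by its edge set,
  a subset of \<open>vertex_pairs n\<close>.\<close>

definition gnp :: "nat \<Rightarrow> real \<Rightarrow> nat set set pmf" where
  "gnp n p = map_pmf (\<lambda>f. {e \<in> vertex_pairs n. f e})
     (Pi_pmf (vertex_pairs n) False (\<lambda>_. bernoulli_pmf p))"

definition degree_of :: "nat set set \<Rightarrow> nat \<Rightarrow> nat" where
  "degree_of E i = card {e \<in> E. i \<in> e}"

text \<open>Matrices are indexed from 0, so row \<open>i\<close> belongs to vertex \<open>Suc i\<close>. The power is only taken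
  for adjacent vertices, whose degrees are positive.\<close>

definition randic_matrix :: "real \<Rightarrow> nat \<Rightarrow> nat set set \<Rightarrow> real mat" where
  "randic_matrix \<alpha> n E = Matrix.mat n n (\<lambda>(i, j).
     if {Suc i, Suc j} \<in> E
     then (real (degree_of E (Suc i)) * real (degree_of E (Suc j))) powr \<alpha>
     else 0)"

text \<open>The multiset of roots of the characteristic polynomial lists the real eigenvalues with
  algebraic multiplicity; a symmetric matrix of dimension \<open>n\<close> has exactly \<open>n\<close> of them.\<close>

definition energy :: "real mat \<Rightarrow> real" where
  "energy A = (\<Sum>x\<in>#proots (char_poly A). \<bar>x\<bar>)"

end

theory Submission
  imports Defs
    "HOL-Probability.Hoeffding"
    "HOL-Real_Asymp.Real_Asymp"
begin

text \<open>Two ideas carry the proof. The first is that the energy of a symmetric matrix is its trace norm, so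
that it can be compared between matrices that are close. With high probability every degree is
\<open>(1 + o(1)) n p\<close> (Hoeffding's inequality and a union bound, \<open>degrees_concentrated_whp\<close>), so the Randic
matrix differs from \<open>(n p) powr (2 \<alpha>)\<close> times the adjacency matrix only by relatively small entries. The
adjacency matrix in turn is its mean \<open>p (J - I)\<close>, \<open>J\<close> being the all-ones matrix, plus a centred matrix
\<open>sqrt n H\<close> with independent entries above the diagonal. Entries of modulus at most \<open>d\<close> change the trace
norm by at most \<open>d n sqrt n\<close>, and the mean has trace norm of order \<open>n\<close>; both are negligible on the scale
\<open>n sqrt n\<close> (\<open>energy_perturbation\<close>, \<open>energy_randic_approx\<close>).

It remains to find the mean absolute eigenvalue of the Wigner matrix \<open>H\<close>
(\<open>wigner_energy_convergence\<close>). The second idea is to get it from the resolvent on the imaginary axis,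
where all its entries have a deterministic bound. Since
\<open>(pi / 2) |x|\<close> is the integral of \<open>x^2 / (x^2 + t^2)\<close> over \<open>t > 0\<close>, the mean of the \<open>|\<lambda>|\<close> over the
eigenvalues is \<open>2 / pi\<close> times the integral of \<open>1 - t Im s(i t)\<close>, where \<open>s(z)\<close> is the normalised trace of
the resolvent \<open>G = (H - z)^{-1}\<close>, the Stieltjes transform of the spectrum.

Put \<open>v = p (1 - p)\<close>, the variance of an edge indicator. A centred Bernoulli variable satisfies an exact
discrete integration by parts, \<open>E ((x - p) F(x)) = v E (F(1) - F(0))\<close>, and switching one edge changes
\<open>H\<close> by a matrix of rank two, so that the change of \<open>G\<close> is an explicit product of resolvent entries.
Applied to the trace of \<open>H G = 1 + z G\<close>, this gives \<open>1 + z E s + v E (s^2) = O(1 / sqrt n)\<close>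
(\<open>expectation_trace_wigner_resolvent\<close>). A single edge has little influence on \<open>s\<close>, so the Efron-Stein
inequality bounds the variance of \<open>s\<close> by \<open>O(1 / n)\<close>. Hence \<open>E s\<close> nearly solves \<open>1 + z m + v m^2 = 0\<close>,
and this equation is stable in the upper half plane. Thus \<open>s(i t)\<close> converges to \<open>i g(t)\<close> with
\<open>v g^2 + t g = 1\<close> (\<open>stieltjes_wigner_convergence\<close>). By dominated convergence the integrals converge to the
integral of \<open>1 - t g(t)\<close>, which is \<open>(4 / 3) sqrt v\<close>, and \<open>(2 / pi) (4 / 3) = 8 / (3 pi)\<close> is the constant
of the theorem.\<close>

section \<open>Spectral decomposition of real symmetric matrices\<close>

text \<open>A complex eigenvector \<open>x + i y\<close> exists for some eigenvalue \<open>z\<close>. Symmetry of \<open>A\<close> gives \<open>y \<bullet> A x = x \<bullet> A y\<close>,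
which forces \<open>Im z (|x|^2 + |y|^2) = 0\<close>; hence \<open>z\<close> is real and \<open>x\<close> or \<open>y\<close> is a real eigenvector.\<close>

lemma real_symmetric_eigenvector_exists:
  fixes A :: "real mat"
  assumes A: "A \<in> carrier_mat n n" and sym: "\<And>i j. i < n \<Longrightarrow> j < n \<Longrightarrow> A $$ (i, j) = A $$ (j, i)"
    and n: "n > 0"
  obtains e v where "\<And>i. i < n \<Longrightarrow> (\<Sum>j<n. A $$ (i, j) * v j) = e * v i" "(\<Sum>i<n. (v i)\<^sup>2) = (1::real)"
proof -
  let ?C = "map_mat complex_of_real A"
  have C: "?C \<in> carrier_mat n n" using A by simp
  obtain es where es: "char_poly ?C = (\<Prod>a\<leftarrow>es. [:- a, 1:])" "length es = n"
    using char_poly_factorized[OF C] by blast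
  with n obtain z es' where "es = z # es'" by (cases es) auto
  then have "poly (char_poly ?C) z = 0" using es by simp
  then have "eigenvalue ?C z" using eigenvalue_root_char_poly[OF C] by simp
  then obtain w where w: "w \<in> carrier_vec n" "w \<noteq> 0\<^sub>v n" "?C *\<^sub>v w = z \<cdot>\<^sub>v w"
    using C by (auto simp: eigenvalue_def eigenvector_def)
  define x y where "x i = Re (w $ i)" and "y i = Im (w $ i)" for i
  have eig: "(\<Sum>j<n. complex_of_real (A $$ (i, j)) * w $ j) = z * w $ i" if i: "i < n" for i
  proof -
    have "(?C *\<^sub>v w) $ i = (\<Sum>j<n. complex_of_real (A $$ (i, j)) * w $ j)"
      using i A w(1) by (auto simp: mult_mat_vec_def scalar_prod_def lessThan_atLeast0 intro!: sum.cong)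
    then show ?thesis using w i by simp
  qed
  have ex: "(\<Sum>j<n. A $$ (i, j) * x j) = Re z * x i - Im z * y i"
   and ey: "(\<Sum>j<n. A $$ (i, j) * y j) = Re z * y i + Im z * x i" if "i < n" for i
    using arg_cong[OF eig[OF that], of Re] arg_cong[OF eig[OF that], of Im]
    by (simp_all add: x_def y_def)
  have "(\<Sum>i<n. y i * (\<Sum>j<n. A $$ (i, j) * x j)) = (\<Sum>i<n. \<Sum>j<n. A $$ (i, j) * (y i * x j))"
    by (simp add: sum_distrib_left mult_ac)
  also have "\<dots> = (\<Sum>j<n. \<Sum>i<n. A $$ (j, i) * (y i * x j))"
    by (subst sum.swap) (intro sum.cong refl, simp add: sym)
  also have "\<dots> = (\<Sum>j<n. x j * (\<Sum>i<n. A $$ (j, i) * y i))"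
    by (simp add: sum_distrib_left mult_ac)
  finally have "(\<Sum>i<n. y i * (Re z * x i - Im z * y i)) = (\<Sum>j<n. x j * (Re z * y j + Im z * x j))"
    by (simp add: ex ey)
  then have 1: "Im z * ((\<Sum>i<n. (x i)\<^sup>2) + (\<Sum>i<n. (y i)\<^sup>2)) = 0"
    by (simp add: algebra_simps power2_eq_square sum.distrib sum_subtractf sum_distrib_left)
  obtain k where k: "k < n" "w $ k \<noteq> 0" using w by (metis carrier_vecD eq_vecI index_zero_vec(1,2))
  have pos: "(\<Sum>i<n. (v i)\<^sup>2) > 0" if "v k \<noteq> 0" for v :: "nat \<Rightarrow> real"
    by (rule sum_pos2[of _ k]) (use k that in auto)
  have nn: "(\<Sum>i<n. (v i)\<^sup>2) \<ge> 0" for v :: "nat \<Rightarrow> real" by (simp add: sum_nonneg)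
  have xy: "x k \<noteq> 0 \<or> y k \<noteq> 0" using k by (auto simp: x_def y_def complex_eq_iff)
  then have "(\<Sum>i<n. (x i)\<^sup>2) + (\<Sum>i<n. (y i)\<^sup>2) > 0"
    using pos[of x] pos[of y] nn[of x] nn[of y] by linarith
  with 1 have im: "Im z = 0" by auto
  obtain u where u: "u k \<noteq> 0" "\<And>i. i < n \<Longrightarrow> (\<Sum>j<n. A $$ (i, j) * u j) = Re z * u i"
    using xy ex ey im by fastforce
  define c where "c = sqrt (\<Sum>i<n. (u i)\<^sup>2)"
  have c: "c > 0" "c\<^sup>2 = (\<Sum>i<n. (u i)\<^sup>2)" using pos[of u, OF u(1)] by (auto simp: c_def)
  show thesis
  proof (rule that[of "\<lambda>i. u i / c" "Re z"])
    show "(\<Sum>j<n. A $$ (i, j) * (u j / c)) = Re z * (u i / c)" if "i < n" for i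
      using u(2)[OF that] by (simp add: sum_divide_distrib[symmetric])
    show "(\<Sum>i<n. (u i / c)\<^sup>2) = 1"
      using c(1) by (simp add: power_divide flip: sum_divide_distrib c(2))
  qed
qed

text \<open>The reflection that exchanges the first standard basis vector with \<open>v\<close>. It is a ready-made orthogonal
matrix with first column \<open>v\<close>, which saves completing \<open>v\<close> to an orthonormal basis.\<close>

lemma householder_reflection:
  fixes v :: "nat \<Rightarrow> real"
  assumes v: "(\<Sum>i<n. (v i)\<^sup>2) = 1" and n: "n > 0"
  obtains W where "W \<in> carrier_mat n n" "W * W = 1\<^sub>m n" "transpose_mat W = W"
    "\<And>i. i < n \<Longrightarrow> W $$ (i, 0) = v i"
proof -
  define w where "w i = v i - (if i = 0 then 1 else 0)" for i
  define N where "N = (\<Sum>i<n. (w i)\<^sup>2)"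
  \<comment> \<open>If \<open>v\<close> is the basis vector itself then \<open>N = 0\<close>, so \<open>c = 0\<close> and \<open>W\<close> is the identity, as it should be.\<close>
  define c where "c = 2 / N"
  define W where "W = mat n n (\<lambda>(i, j). (if i = j then 1 else 0) - c * w i * w j)"
  have cc: "c * c * N = 2 * c" by (simp add: c_def)
  have "(w i)\<^sup>2 = (v i)\<^sup>2 - 2 * (if i = 0 then v i else 0) + (if i = 0 then 1 else 0)" for i
    by (simp add: w_def power2_eq_square algebra_simps)
  then have "N = 1 - 2 * v 0 + 1"
    using n v by (simp add: N_def sum.distrib sum_subtractf flip: sum_distrib_left)
  then have Nw: "N = - 2 * w 0" by (simp add: w_def)
  have w0: "w i = 0" if "N = 0" "i < n" for i
    using that by (simp add: N_def sum_nonneg_eq_0_iff)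
  have col: "W $$ (i, 0) = v i" if "i < n" for i
  proof (cases "N = 0")
    case True
    then show ?thesis using that n w0[OF True that] by (simp add: W_def w_def)
  next
    case False
    then have "c * w 0 = - 1" by (simp add: c_def Nw)
    then have "c * w i * w 0 = - w i" by (metis mult.assoc mult.commute mult_minus1)
    then show ?thesis using that n by (simp add: W_def) (simp add: w_def)
  qed
  have "W * W = 1\<^sub>m n"
  proof (rule eq_matI)
    fix i j assume ij: "i < dim_row (1\<^sub>m n :: real mat)" "j < dim_col (1\<^sub>m n :: real mat)"
    then have "(W * W) $$ (i, j) =
      (\<Sum>k<n. ((if i = k then 1 else 0) - c * w i * w k) * ((if k = j then 1 else 0) - c * w k * w j))"
      by (simp add: W_def scalar_prod_def lessThan_atLeast0)
    also have "\<dots> = (\<Sum>k<n. (if i = k then (if i = j then 1 else 0) else 0)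
        - (if i = k then c * w i * w j else 0) - (if k = j then c * w i * w j else 0)
        + c * c * w i * w j * (w k)\<^sup>2)"
      by (intro sum.cong refl) (auto simp: algebra_simps power2_eq_square)
    also have "\<dots> = (if i = j then 1 else 0) - 2 * c * w i * w j + c * c * w i * w j * N"
      using ij by (simp add: sum.distrib sum_subtractf N_def sum_distrib_left)
    also have "c * c * w i * w j * N = (c * c * N) * (w i * w j)" by simp
    finally show "(W * W) $$ (i, j) = 1\<^sub>m n $$ (i, j)" using ij by (simp add: cc)
  qed (auto simp: W_def)
  moreover have "transpose_mat W = W" by (rule eq_matI) (auto simp: W_def)
  moreover have "W \<in> carrier_mat n n" by (simp add: W_def)
  ultimately show thesis using that col by blast
qed

text \<open>Induction on the dimension. Conjugating by a reflection whose first column is a unit eigenvector makes the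
first column of \<open>A\<close> vanish off the diagonal; by symmetry so does the first row, and the remaining block is
again symmetric.\<close>

theorem real_symmetric_diagonalization:
  fixes A :: "real mat"
  assumes "A \<in> carrier_mat n n" "transpose_mat A = A"
  shows "\<exists>U D. U \<in> carrier_mat n n \<and> D \<in> carrier_mat n n \<and> diagonal_mat D \<and>
    U * transpose_mat U = 1\<^sub>m n \<and> A = U * D * transpose_mat U"
  using assms
proof (induction n arbitrary: A)
  case 0
  then show ?case
    by (intro exI[of _ "1\<^sub>m 0"]) (auto intro!: exI[of _ "1\<^sub>m 0"] simp: diagonal_mat_def)
next
  case (Suc n)
  have sym: "A $$ (i, j) = A $$ (j, i)" if "i < Suc n" "j < Suc n" for i j
    using Suc.prems that by (metis carrier_matD index_transpose_mat(1))
  obtain e v where v: "\<And>i. i < Suc n \<Longrightarrow> (\<Sum>j<Suc n. A $$ (i, j) * v j) = e * v i"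
      "(\<Sum>i<Suc n. (v i)\<^sup>2) = (1::real)"
    using real_symmetric_eigenvector_exists[OF Suc.prems(1) sym zero_less_Suc] by metis
  obtain W where W: "W \<in> carrier_mat (Suc n) (Suc n)" "W * W = 1\<^sub>m (Suc n)" "transpose_mat W = W"
    "\<And>i. i < Suc n \<Longrightarrow> W $$ (i, 0) = v i"
    using householder_reflection[OF v(2) zero_less_Suc] by blast
  define B where "B = W * A * W"
  have B: "B \<in> carrier_mat (Suc n) (Suc n)" using W Suc.prems by (simp add: B_def)
  have tB: "transpose_mat B = B"
    using W(1,3) Suc.prems
    by (simp add: B_def transpose_mult[of _ "Suc n" "Suc n" _ "Suc n"] assoc_mult_mat[of _ "Suc n" "Suc n" _ "Suc n" _ "Suc n"])
  have symB: "B $$ (i, j) = B $$ (j, i)" if "i < Suc n" "j < Suc n" for i j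
    using tB B that by (metis carrier_matD index_transpose_mat(1))
  have AW: "(A * W) $$ (i, 0) = e * W $$ (i, 0)" if "i < Suc n" for i
    using that Suc.prems W(1,4) v(1)[OF that]
    by (simp add: scalar_prod_def lessThan_atLeast0)
  have B0: "B $$ (i, 0) = (if i = 0 then e else 0)" if i: "i < Suc n" for i
  proof -
    have "B = W * (A * W)" using W Suc.prems by (simp add: B_def assoc_mult_mat[of _ "Suc n" "Suc n" _ "Suc n" _ "Suc n"])
    then have "B $$ (i, 0) = (\<Sum>k<Suc n. W $$ (i, k) * (A * W) $$ (k, 0))"
      using i W Suc.prems by (simp add: scalar_prod_def lessThan_atLeast0 del: sum.op_ivl_Suc)
    also have "\<dots> = e * (\<Sum>k<Suc n. W $$ (i, k) * W $$ (k, 0))"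
      unfolding sum_distrib_left by (intro sum.cong refl) (simp add: AW del: index_mult_mat)
    also have "(\<Sum>k<Suc n. W $$ (i, k) * W $$ (k, 0)) = (W * W) $$ (i, 0)"
      using i W(1) by (simp add: scalar_prod_def lessThan_atLeast0 del: sum.op_ivl_Suc)
    finally show ?thesis using i W(2) by simp
  qed
  define B3 where "B3 = mat n n (\<lambda>(i, j). B $$ (Suc i, Suc j))"
  define E where "E = mat 1 1 (\<lambda>_. e)"
  have Bblock: "B = four_block_mat E (0\<^sub>m 1 n) (0\<^sub>m n 1) B3"
    by (rule eq_matI) (use B B0 symB[of 0] in \<open>auto simp: E_def B3_def\<close>)
  have B3: "B3 \<in> carrier_mat n n" "transpose_mat B3 = B3"
    using symB by (auto simp: B3_def intro!: eq_matI)
  from Suc.IH[OF this] obtain U D where U: "U \<in> carrier_mat n n" "D \<in> carrier_mat n n" "diagonal_mat D"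
    "U * transpose_mat U = 1\<^sub>m n" "B3 = U * D * transpose_mat U" by blast
  define T where "T = four_block_mat (1\<^sub>m 1) (0\<^sub>m 1 n) (0\<^sub>m n 1) U"
  define F where "F = four_block_mat E (0\<^sub>m 1 n) (0\<^sub>m n 1) D"
  have E: "E \<in> carrier_mat 1 1" by (simp add: E_def)
  have T: "T \<in> carrier_mat (Suc n) (Suc n)" and F: "F \<in> carrier_mat (Suc n) (Suc n)"
    using U E by (auto simp: T_def F_def)
  have tT: "transpose_mat T = four_block_mat (1\<^sub>m 1) (0\<^sub>m 1 n) (0\<^sub>m n 1) (transpose_mat U)"
    unfolding T_def using U by (subst transpose_four_block_mat[of _ 1 1 _ n _ n]) auto
  have TT: "T * transpose_mat T = 1\<^sub>m (Suc n)"
    unfolding tT unfolding T_def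
    using U by (subst mult_four_block_mat[of _ 1 1 _ n _ n _ _ 1 _ n]) (auto intro!: eq_matI)
  have "T * F = four_block_mat E (0\<^sub>m 1 n) (0\<^sub>m n 1) (U * D)"
    unfolding T_def F_def
    using U E by (subst mult_four_block_mat[of _ 1 1 _ n _ n _ _ 1 _ n]) auto
  then have "T * F * transpose_mat T = four_block_mat E (0\<^sub>m 1 n) (0\<^sub>m n 1) B3"
    unfolding tT
    using U E by (simp, subst mult_four_block_mat[of _ 1 1 _ n _ n _ _ 1 _ n]) auto
  then have BT: "B = T * F * transpose_mat T" by (simp add: Bblock)
  note as = assoc_mult_mat[of _ "Suc n" "Suc n" _ "Suc n" _ "Suc n"]
  have Ac: "A \<in> carrier_mat (Suc n) (Suc n)" by fact
  have tT': "transpose_mat T \<in> carrier_mat (Suc n) (Suc n)" using T by simp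
  have tWT: "transpose_mat (W * T) = transpose_mat T * W"
    using W T by (simp add: transpose_mult[of _ "Suc n" "Suc n" _ "Suc n"])
  have WWX: "W * (W * X) = X" if "X \<in> carrier_mat (Suc n) (Suc n)" for X
    using that W(1,2) by (simp flip: as)
  have TTX: "T * (transpose_mat T * X) = X" if "X \<in> carrier_mat (Suc n) (Suc n)" for X
    using that T TT by (simp flip: as)
  have "A = W * B * W"
    using Ac W by (simp add: B_def as WWX)
  then have "A = (W * T) * F * transpose_mat (W * T)"
    using T F W tT' by (simp add: BT tWT as)
  moreover have "(W * T) * transpose_mat (W * T) = 1\<^sub>m (Suc n)"
    using T W tT' by (simp add: tWT as TTX)
  moreover have "diagonal_mat F"
    using U E by (auto simp: diagonal_mat_def F_def)
  moreover have "W * T \<in> carrier_mat (Suc n) (Suc n)" using W T by simp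
  ultimately show ?case using F by blast
qed

text \<open>Row \<open>u k\<close> is the \<open>k\<close>-th eigenvector, with eigenvalue \<open>l k\<close>. Both orthonormality relations are recorded,
for rows and for columns, because each serves as a Parseval identity. Matrices are plain functions from
here on, since only finite sums of their entries matter.\<close>

definition eigen_basis :: "nat \<Rightarrow> (nat \<Rightarrow> nat \<Rightarrow> real) \<Rightarrow> (nat \<Rightarrow> real) \<Rightarrow> (nat \<Rightarrow> nat \<Rightarrow> real) \<Rightarrow> bool" where
  "eigen_basis n A l u \<longleftrightarrow>
     (\<forall>i<n. \<forall>j<n. A i j = (\<Sum>k<n. l k * u k i * u k j)) \<and>
     (\<forall>k<n. \<forall>m<n. (\<Sum>i<n. u k i * u m i) = (if k = m then 1 else 0)) \<and>
     (\<forall>i<n. \<forall>j<n. (\<Sum>k<n. u k i * u k j) = (if i = j then 1 else 0))"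

lemma eigen_basis_exists:
  assumes "\<And>i j. i < n \<Longrightarrow> j < n \<Longrightarrow> A i j = A j i"
  shows "\<exists>l u. eigen_basis n A l u"
proof -
  define M where "M = mat n n (\<lambda>(i, j). A i j)"
  have M: "M \<in> carrier_mat n n" "transpose_mat M = M"
    using assms by (auto simp: M_def intro!: eq_matI)
  obtain U D where U: "U \<in> carrier_mat n n" "D \<in> carrier_mat n n" "diagonal_mat D"
    "U * transpose_mat U = 1\<^sub>m n" "M = U * D * transpose_mat U"
    using real_symmetric_diagonalization[OF M] by blast
  have UU: "transpose_mat U * U = 1\<^sub>m n"
    using U by (intro mat_mult_left_right_inverse[of U n]) auto
  have UD: "(U * D) $$ (i, k) = U $$ (i, k) * D $$ (k, k)" if "i < n" "k < n" for i k
  proof -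
    have "(U * D) $$ (i, k) = (\<Sum>m<n. U $$ (i, m) * D $$ (m, k))"
      using that U(1,2) by (simp add: scalar_prod_def lessThan_atLeast0)
    also have "\<dots> = (\<Sum>m<n. if m = k then U $$ (i, k) * D $$ (k, k) else 0)"
      using that U(2,3) by (intro sum.cong) (auto simp: diagonal_mat_def)
    finally show ?thesis using that by simp
  qed
  have mult_transpose: "(X * transpose_mat U) $$ (i, j) = (\<Sum>k<n. X $$ (i, k) * U $$ (j, k))"
    if "X \<in> carrier_mat n n" "i < n" "j < n" for X i j
    using that U(1) by (simp add: scalar_prod_def lessThan_atLeast0)
  have "A i j = (\<Sum>k<n. D $$ (k, k) * U $$ (i, k) * U $$ (j, k))" if "i < n" "j < n" for i j
  proof -
    have "A i j = (U * D * transpose_mat U) $$ (i, j)" using that U(5) by (simp add: M_def flip: U(5))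
    also have "\<dots> = (\<Sum>k<n. (U * D) $$ (i, k) * U $$ (j, k))"
      by (rule mult_transpose) (use that U(1,2) in auto)
    also have "\<dots> = (\<Sum>k<n. D $$ (k, k) * U $$ (i, k) * U $$ (j, k))"
      using that by (intro sum.cong refl) (simp add: UD del: index_mult_mat)
    finally show ?thesis .
  qed
  moreover have "(\<Sum>i<n. U $$ (i, k) * U $$ (i, m)) = (if k = m then 1 else 0)" if "k < n" "m < n" for k m
    using arg_cong[OF UU, of "\<lambda>X. X $$ (k, m)"] that U(1)
    by (simp add: scalar_prod_def lessThan_atLeast0)
  moreover have "(\<Sum>k<n. U $$ (i, k) * U $$ (j, k)) = (if i = j then 1 else 0)" if "i < n" "j < n" for i j
    using arg_cong[OF U(4), of "\<lambda>X. X $$ (i, j)"] that U(1)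
    by (simp add: scalar_prod_def lessThan_atLeast0)
  ultimately show ?thesis
    unfolding eigen_basis_def
    by (intro exI[of _ "\<lambda>k. D $$ (k, k)"] exI[of _ "\<lambda>k i. U $$ (i, k)"]) auto
qed

section \<open>The energy as a trace norm\<close>

lemma energy_eq_sum_abs_eigenvalues:
  assumes "eigen_basis n A l u"
  shows "energy (mat n n (\<lambda>(i, j). A i j)) = (\<Sum>k<n. \<bar>l k\<bar>)"
proof -
  define M where "M = mat n n (\<lambda>(i, j). A i j)"
  define U where "U = mat n n (\<lambda>(i, k). u k i)"
  define D where "D = mat n n (\<lambda>(i, k). if i = k then l k else 0)"
  have carr: "M \<in> carrier_mat n n" "U \<in> carrier_mat n n" "D \<in> carrier_mat n n"
    by (auto simp: M_def U_def D_def)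
  have UU: "U * transpose_mat U = 1\<^sub>m n" "transpose_mat U * U = 1\<^sub>m n"
    using assms by (auto simp: eigen_basis_def U_def scalar_prod_def lessThan_atLeast0 intro!: eq_matI)
  have UD: "U * D = mat n n (\<lambda>(i, k). u k i * l k)"
    by (rule eq_matI) (auto simp: U_def D_def scalar_prod_def if_distrib[of "\<lambda>x. _ * x"] cong: if_cong)
  have "M = U * D * transpose_mat U"
    unfolding UD using assms
    by (auto simp: M_def U_def eigen_basis_def scalar_prod_def lessThan_atLeast0 mult_ac intro!: eq_matI sum.cong)
  then have "similar_mat M D"
    using carr UU by (intro similar_matI[of _ _ U "transpose_mat U" n]) auto
  then have "char_poly M = char_poly D" by (rule char_poly_similar)
  also have "\<dots> = (\<Prod>a\<leftarrow>diag_mat D. [:- a, 1:])"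
    by (rule char_poly_upper_triangular[of _ n]) (auto simp: D_def)
  also have "diag_mat D = map l [0..<n]"
    by (auto simp: diag_mat_def D_def)
  finally have cp: "char_poly M = prod_list (map (\<lambda>a. [:- a, 1:]) (map l [0..<n]))" .
  have proots_linear: "proots (prod_list (map (\<lambda>a. [:- a, 1:]) xs)) = mset xs" for xs :: "real list"
  proof (induction xs)
    case (Cons a xs)
    have "prod_list (map (\<lambda>a. [:- a, 1:]) xs) \<noteq> 0" by (auto simp: prod_list_zero_iff)
    then show ?case using Cons by (simp add: proots_mult del: mult_pCons_left)
  qed simp
  have "energy M = (\<Sum>x\<in>#mset (map l [0..<n]). \<bar>x\<bar>)" unfolding energy_def cp proots_linear by (rule refl)
  also have "\<dots> = sum_list (map abs (map l [0..<n]))"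
    by (metis mset_map sum_mset_sum_list)
  also have "\<dots> = (\<Sum>k<n. \<bar>l k\<bar>)" by (simp add: sum_list_distinct_conv_sum_set lessThan_atLeast0 o_def)
  finally show ?thesis by (simp add: M_def)
qed

lemma eigen_basis_parseval:
  assumes "eigen_basis n A l u"
  shows "(\<Sum>k<n. (\<Sum>i<n. x i * u k i)\<^sup>2) = (\<Sum>i<n. (x i)\<^sup>2)"
    and "(\<Sum>i<n. (\<Sum>k<n. c k * u k i)\<^sup>2) = (\<Sum>k<n. (c k)\<^sup>2)"
proof -
  have parseval: "(\<Sum>k<n. (\<Sum>i<n. x i * u k i)\<^sup>2) = (\<Sum>i<n. (x i)\<^sup>2)"
    if "\<And>i j. i < n \<Longrightarrow> j < n \<Longrightarrow> (\<Sum>k<n. u k i * u k j) = (if i = j then 1 else 0)"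
    for u :: "nat \<Rightarrow> nat \<Rightarrow> real" and x
  proof -
    have "(\<Sum>k<n. (\<Sum>i<n. x i * u k i)\<^sup>2) = (\<Sum>k<n. \<Sum>i<n. \<Sum>j<n. x i * x j * (u k i * u k j))"
      by (simp add: power2_eq_square sum_product mult_ac)
    also have "\<dots> = (\<Sum>i<n. \<Sum>j<n. \<Sum>k<n. x i * x j * (u k i * u k j))"
      by (rule trans[OF sum.swap], rule sum.cong[OF refl], rule sum.swap)
    also have "\<dots> = (\<Sum>i<n. \<Sum>j<n. if i = j then x i * x i else 0)"
      by (intro sum.cong refl) (simp add: that flip: sum_distrib_left)
    finally show ?thesis by (simp add: power2_eq_square)
  qed
  show "(\<Sum>k<n. (\<Sum>i<n. x i * u k i)\<^sup>2) = (\<Sum>i<n. (x i)\<^sup>2)"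
    using assms by (intro parseval) (auto simp: eigen_basis_def)
  show "(\<Sum>i<n. (\<Sum>k<n. c k * u k i)\<^sup>2) = (\<Sum>k<n. (c k)\<^sup>2)"
    using assms by (intro parseval) (auto simp: eigen_basis_def)
qed

text \<open>The trace of \<open>A Q\<close> in terms of both spectral decompositions: eigenvalues are weighted by the squared
overlaps of the eigenvectors.\<close>

lemma frobenius_product_spectral:
  fixes l s :: "nat \<Rightarrow> real"
  assumes "\<And>i j. i < n \<Longrightarrow> j < n \<Longrightarrow> A i j = (\<Sum>k<n. l k * v k i * v k j)"
    and "\<And>i j. i < n \<Longrightarrow> j < n \<Longrightarrow> Q i j = (\<Sum>m<n. s m * u m i * u m j)"
  shows "(\<Sum>i<n. \<Sum>j<n. A i j * Q i j) = (\<Sum>k<n. l k * (\<Sum>m<n. s m * (\<Sum>i<n. v k i * u m i)\<^sup>2))"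
proof -
  have "(\<Sum>i<n. \<Sum>j<n. A i j * Q i j) =
      (\<Sum>i<n. \<Sum>j<n. \<Sum>k<n. \<Sum>m<n. (l k * v k i * v k j) * (s m * u m i * u m j))"
    by (intro sum.cong refl) (simp add: assms sum_product)
  also have "\<dots> = (\<Sum>i<n. \<Sum>k<n. \<Sum>m<n. \<Sum>j<n. (l k * v k i * v k j) * (s m * u m i * u m j))"
    by (rule sum.cong[OF refl], rule trans[OF sum.swap], rule sum.cong[OF refl], rule sum.swap)
  also have "\<dots> = (\<Sum>k<n. \<Sum>m<n. \<Sum>i<n. \<Sum>j<n. (l k * v k i * v k j) * (s m * u m i * u m j))"
    by (rule trans[OF sum.swap], rule sum.cong[OF refl], rule trans[OF sum.swap], rule sum.cong[OF refl], rule refl)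
  also have "\<dots> = (\<Sum>k<n. l k * (\<Sum>m<n. s m * (\<Sum>i<n. v k i * u m i)\<^sup>2))"
    by (simp add: power2_eq_square sum_product sum_distrib_left mult_ac)
  finally show ?thesis .
qed

lemma sum_abs_le_sqrt_card:
  "(\<Sum>j<n. \<bar>x j\<bar>) \<le> sqrt (real n) * sqrt (\<Sum>j<n. (x j)\<^sup>2)" for x :: "nat \<Rightarrow> real"
  using L2_set_mult_ineq[of "\<lambda>_. 1" x "{..<n}"] by (simp add: L2_set_def)

text \<open>Let \<open>Q = sgn A\<close>, with the eigenvectors of \<open>A\<close> and the signs of its eigenvalues. The trace of \<open>A Q\<close> is the
trace norm of \<open>A\<close>, while the trace of \<open>B Q\<close> is at most that of \<open>B\<close> because \<open>Q\<close> is a contraction. So only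
the trace of \<open>(A - B) Q\<close> has to be estimated. The all-ones matrix contributes the quadratic form of \<open>Q\<close> at
the all-ones vector, at most \<open>n\<close>; the diagonal of \<open>Q\<close> contributes at most \<open>n\<close>; and entries bounded by \<open>d\<close>
contribute at most \<open>d sqrt n\<close> per row, as the rows of \<open>Q\<close> have norm at most \<open>1\<close>.\<close>

lemma sum_abs_eigenvalues_perturbation:
  assumes A: "eigen_basis n A l u" and B: "eigen_basis n B m v"
    and diag: "\<And>i. i < n \<Longrightarrow> A i i = B i i"
    and off: "\<And>i j. i < n \<Longrightarrow> j < n \<Longrightarrow> i \<noteq> j \<Longrightarrow> \<bar>A i j - B i j - c\<bar> \<le> d"
    and d: "d \<ge> 0"
  shows "(\<Sum>k<n. \<bar>l k\<bar>) \<le> (\<Sum>k<n. \<bar>m k\<bar>) + 2 * \<bar>c\<bar> * real n + d * (real n * sqrt (real n))"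
proof -
  define s where "s k = sgn (l k)" for k
  define Q where "Q i j = (\<Sum>k<n. s k * u k i * u k j)" for i j
  have s: "\<bar>s k\<bar> \<le> 1" for k by (simp add: s_def abs_sgn_eq)
  have quad: "\<bar>\<Sum>k<n. s k * (\<Sum>i<n. x i * u k i)\<^sup>2\<bar> \<le> (\<Sum>i<n. (x i)\<^sup>2)" for x
  proof -
    have "\<bar>\<Sum>k<n. s k * (\<Sum>i<n. x i * u k i)\<^sup>2\<bar> \<le> (\<Sum>k<n. \<bar>s k * (\<Sum>i<n. x i * u k i)\<^sup>2\<bar>)"
      by (rule sum_abs)
    also have "\<dots> \<le> (\<Sum>k<n. (\<Sum>i<n. x i * u k i)\<^sup>2)"
      by (intro sum_mono) (use s in \<open>auto simp: abs_mult intro: mult_left_le_one_le\<close>)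
    finally show ?thesis by (simp add: eigen_basis_parseval[OF A])
  qed
  have AQ: "(\<Sum>i<n. \<Sum>j<n. A i j * Q i j) = (\<Sum>k<n. \<bar>l k\<bar>)"
  proof -
    have "(\<Sum>i<n. \<Sum>j<n. A i j * Q i j) = (\<Sum>k<n. l k * (\<Sum>m<n. s m * (\<Sum>i<n. u k i * u m i)\<^sup>2))"
      by (rule frobenius_product_spectral) (use A in \<open>auto simp: eigen_basis_def Q_def\<close>)
    also have "\<dots> = (\<Sum>k<n. l k * (\<Sum>m<n. if m = k then s k else 0))"
      using A by (intro sum.cong refl arg_cong2[of _ _ _ _ "(*)"]) (auto simp: eigen_basis_def)
    also have "\<dots> = (\<Sum>k<n. \<bar>l k\<bar>)" by (intro sum.cong refl) (simp add: s_def abs_sgn)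
    finally show ?thesis .
  qed
  have BQ: "(\<Sum>i<n. \<Sum>j<n. B i j * Q i j) \<le> (\<Sum>k<n. \<bar>m k\<bar>)"
  proof -
    have "(\<Sum>i<n. \<Sum>j<n. B i j * Q i j) = (\<Sum>k<n. m k * (\<Sum>r<n. s r * (\<Sum>i<n. v k i * u r i)\<^sup>2))"
      by (rule frobenius_product_spectral) (use B in \<open>auto simp: eigen_basis_def Q_def\<close>)
    also have "\<dots> \<le> (\<Sum>k<n. \<bar>m k\<bar>)"
    proof (intro sum_mono)
      fix k assume k: "k \<in> {..<n}"
      have "(\<Sum>i<n. (v k i)\<^sup>2) = 1" using B k by (simp add: eigen_basis_def power2_eq_square)
      then have "\<bar>\<Sum>r<n. s r * (\<Sum>i<n. v k i * u r i)\<^sup>2\<bar> \<le> 1" using quad[of "v k"] by simp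
      then have "\<bar>m k * (\<Sum>r<n. s r * (\<Sum>i<n. v k i * u r i)\<^sup>2)\<bar> \<le> \<bar>m k\<bar>"
        unfolding abs_mult by (rule mult_left_le) simp
      then show "m k * (\<Sum>r<n. s r * (\<Sum>i<n. v k i * u r i)\<^sup>2) \<le> \<bar>m k\<bar>" by linarith
    qed
    finally show ?thesis .
  qed
  have J: "\<bar>\<Sum>i<n. \<Sum>j<n. Q i j\<bar> \<le> real n"
  proof -
    have "(\<Sum>i<n. \<Sum>j<n. Q i j) = (\<Sum>k<n. s k * (\<Sum>i<n. 1 * u k i)\<^sup>2)"
    proof -
      have "(\<Sum>i<n. \<Sum>j<n. Q i j) = (\<Sum>i<n. \<Sum>k<n. \<Sum>j<n. s k * u k i * u k j)"
        unfolding Q_def by (rule sum.cong[OF refl], rule sum.swap)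
      also have "\<dots> = (\<Sum>k<n. \<Sum>i<n. \<Sum>j<n. s k * u k i * u k j)" by (rule sum.swap)
      finally show ?thesis by (simp add: power2_eq_square sum_product sum_distrib_left mult_ac)
    qed
    then show ?thesis using quad[of "\<lambda>_. 1"] by simp
  qed
  have tr: "\<bar>\<Sum>i<n. Q i i\<bar> \<le> real n"
  proof -
    have "\<bar>Q i i\<bar> \<le> 1" if "i < n" for i
    proof -
      have "Q i i = (\<Sum>k<n. s k * (\<Sum>j<n. (if j = i then 1 else 0) * u k j)\<^sup>2)"
        using that by (simp add: Q_def power2_eq_square if_distrib[of "\<lambda>x. x * _"] mult.assoc cong: if_cong)
      then show ?thesis
        using quad[of "\<lambda>j. if j = i then 1 else 0"] that
        by (simp add: if_distrib[of "\<lambda>x. x\<^sup>2"] cong: if_cong)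
    qed
    then have "(\<Sum>i<n. \<bar>Q i i\<bar>) \<le> (\<Sum>i<n. 1)" by (intro sum_mono) auto
    also have "\<dots> = real n" by simp
    finally show ?thesis using sum_abs[of "\<lambda>i. Q i i" "{..<n}"] by linarith
  qed
  have row: "(\<Sum>j<n. \<bar>Q i j\<bar>) \<le> sqrt (real n)" if "i < n" for i
  proof -
    have "(\<Sum>j<n. (Q i j)\<^sup>2) = (\<Sum>k<n. (s k * u k i)\<^sup>2)"
      unfolding Q_def by (rule eigen_basis_parseval(2)[OF A])
    also have "\<dots> \<le> (\<Sum>k<n. u k i * u k i)"
      using s by (intro sum_mono)
        (auto simp: power_mult_distrib abs_square_le_1 simp flip: power2_eq_square intro!: mult_left_le_one_le)
    also have "\<dots> = 1" using A that by (simp add: eigen_basis_def)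
    finally have "sqrt (\<Sum>j<n. (Q i j)\<^sup>2) \<le> 1" by simp
    then have "sqrt (real n) * sqrt (\<Sum>j<n. (Q i j)\<^sup>2) \<le> sqrt (real n)" by (intro mult_left_le) auto
    with sum_abs_le_sqrt_card[of "Q i" n] show ?thesis by linarith
  qed
  define F where "F i j = (if i = j then 0 else A i j - B i j - c)" for i j
  have F: "\<bar>F i j\<bar> \<le> d" if "i < n" "j < n" for i j using off d that by (auto simp: F_def)
  have "(\<Sum>i<n. \<Sum>j<n. F i j * Q i j) \<le> (\<Sum>i<n. d * sqrt (real n))"
  proof (intro sum_mono)
    fix i assume i: "i \<in> {..<n}"
    have "(\<Sum>j<n. F i j * Q i j) \<le> (\<Sum>j<n. d * \<bar>Q i j\<bar>)"
    proof (intro sum_mono)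
      fix j assume j: "j \<in> {..<n}"
      have "F i j * Q i j \<le> \<bar>F i j\<bar> * \<bar>Q i j\<bar>" by (simp flip: abs_mult)
      also have "\<dots> \<le> d * \<bar>Q i j\<bar>" using F i j by (intro mult_right_mono) auto
      finally show "F i j * Q i j \<le> d * \<bar>Q i j\<bar>" .
    qed
    also have "\<dots> \<le> d * sqrt (real n)"
      unfolding sum_distrib_left[symmetric] using d row i by (intro mult_left_mono) auto
    finally show "(\<Sum>j<n. F i j * Q i j) \<le> d * sqrt (real n)" .
  qed
  then have FQ: "(\<Sum>i<n. \<Sum>j<n. F i j * Q i j) \<le> d * (real n * sqrt (real n))" by (simp add: mult_ac)
  have "A i j * Q i j = B i j * Q i j + F i j * Q i j + c * Q i j - (if i = j then c * Q i i else 0)"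
    if "i < n" "j < n" for i j
    using diag that by (auto simp: F_def algebra_simps)
  then have "(\<Sum>i<n. \<Sum>j<n. A i j * Q i j) = (\<Sum>i<n. \<Sum>j<n. B i j * Q i j) +
      (\<Sum>i<n. \<Sum>j<n. F i j * Q i j) + c * (\<Sum>i<n. \<Sum>j<n. Q i j) - c * (\<Sum>i<n. Q i i)"
    by (simp add: sum.distrib sum_subtractf sum_distrib_left)
  moreover have "c * (\<Sum>i<n. \<Sum>j<n. Q i j) \<le> \<bar>c\<bar> * real n"
    using mult_left_mono[OF J, of "\<bar>c\<bar>"] by (simp flip: abs_mult)
  moreover have "- (c * (\<Sum>i<n. Q i i)) \<le> \<bar>c\<bar> * real n"
    using mult_left_mono[OF tr, of "\<bar>c\<bar>"] by (simp flip: abs_mult)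
  ultimately show ?thesis using AQ BQ FQ by linarith
qed

lemma energy_perturbation:
  fixes A B :: "nat \<Rightarrow> nat \<Rightarrow> real"
  assumes "\<And>i j. i < n \<Longrightarrow> j < n \<Longrightarrow> A i j = A j i" "\<And>i j. i < n \<Longrightarrow> j < n \<Longrightarrow> B i j = B j i"
    and diag: "\<And>i. i < n \<Longrightarrow> A i i = B i i"
    and off: "\<And>i j. i < n \<Longrightarrow> j < n \<Longrightarrow> i \<noteq> j \<Longrightarrow> \<bar>A i j - B i j - c\<bar> \<le> d"
    and d: "d \<ge> 0"
  shows "\<bar>energy (mat n n (\<lambda>(i, j). A i j)) - energy (mat n n (\<lambda>(i, j). B i j))\<bar>
    \<le> 2 * \<bar>c\<bar> * real n + d * (real n * sqrt (real n))"
proof -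
  obtain l u where A: "eigen_basis n A l u" using eigen_basis_exists[of n A] assms(1) by blast
  obtain m v where B: "eigen_basis n B m v" using eigen_basis_exists[of n B] assms(2) by blast
  have off': "\<bar>B i j - A i j - (- c)\<bar> \<le> d" if "i < n" "j < n" "i \<noteq> j" for i j
    using off[OF that] by linarith
  show ?thesis
    using sum_abs_eigenvalues_perturbation[OF A B diag off d]
      sum_abs_eigenvalues_perturbation[OF B A diag[symmetric] off' d]
    unfolding energy_eq_sum_abs_eigenvalues[OF A] energy_eq_sum_abs_eigenvalues[OF B] by simp
qed

section \<open>Independent Bernoulli variables\<close>

abbreviation bernoulli_field :: "'a set \<Rightarrow> real \<Rightarrow> ('a \<Rightarrow> bool) pmf" where
  "bernoulli_field A p \<equiv> Pi_pmf A False (\<lambda>_. bernoulli_pmf p)"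

lemma finite_set_bernoulli_field:
  assumes "finite A" shows "finite (set_pmf (bernoulli_field A p))"
proof -
  have "set_pmf (bernoulli_field A p) \<subseteq> PiE_dflt A False (\<lambda>_. UNIV)"
    using set_Pi_pmf_subset'[OF assms, of False "\<lambda>_. bernoulli_pmf p"] by (auto simp: PiE_dflt_def)
  then show ?thesis by (rule finite_subset) (use assms in auto)
qed

lemma integrable_bernoulli_field:
  fixes F :: "('a \<Rightarrow> bool) \<Rightarrow> 'b :: {banach, second_countable_topology}"
  assumes "finite A" shows "integrable (measure_pmf (bernoulli_field A p)) F"
  by (rule integrable_measure_pmf_finite[OF finite_set_bernoulli_field[OF assms]])

lemma expectation_bernoulli_field_insert:
  fixes F :: "('a \<Rightarrow> bool) \<Rightarrow> 'b :: {banach, second_countable_topology}"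
  assumes A: "finite A" "e \<notin> A" and p: "0 \<le> p" "p \<le> 1"
  shows "measure_pmf.expectation (bernoulli_field (insert e A) p) F =
    p *\<^sub>R measure_pmf.expectation (bernoulli_field A p) (\<lambda>f. F (f(e := True)))
    + (1 - p) *\<^sub>R measure_pmf.expectation (bernoulli_field A p) (\<lambda>f. F (f(e := False)))"
proof -
  let ?X = "\<lambda>y. map_pmf (\<lambda>f. f(e := y)) (bernoulli_field A p)"
  have eq: "bernoulli_field (insert e A) p = bind_pmf (bernoulli_pmf p) ?X"
    using A by (subst Pi_pmf_insert') (auto simp: map_pmf_def)
  have "measure_pmf.expectation (bernoulli_field (insert e A) p) F =
      (\<Sum>b\<in>UNIV. pmf (bernoulli_pmf p) b *\<^sub>R measure_pmf.expectation (?X b) F)"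
    unfolding eq using A(1)
    by (intro pmf_expectation_bind) (auto intro: finite_set_bernoulli_field)
  also have "\<dots> = p *\<^sub>R measure_pmf.expectation (?X True) F + (1 - p) *\<^sub>R measure_pmf.expectation (?X False) F"
    using p by (simp add: UNIV_bool)
  finally show ?thesis by simp
qed

text \<open>The discrete counterpart of Gaussian integration by parts. It is exact: conditioned on the other
variables, the left side is \<open>p (1 - p) F(1) + (1 - p) (- p) F(0)\<close>.\<close>

lemma expectation_centered_bernoulli_mult:
  fixes F :: "('a \<Rightarrow> bool) \<Rightarrow> 'b :: {banach, second_countable_topology}"
  assumes A: "finite A" "e \<in> A" and p: "0 \<le> p" "p \<le> 1"
  shows "measure_pmf.expectation (bernoulli_field A p) (\<lambda>f. (of_bool (f e) - p) *\<^sub>R F f) =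
    (p * (1 - p)) *\<^sub>R measure_pmf.expectation (bernoulli_field A p) (\<lambda>f. F (f(e := True)) - F (f(e := False)))"
proof -
  obtain B where B: "A = insert e B" "e \<notin> B" "finite B"
    using A by (metis Set.set_insert finite_insert)
  have [simp]: "integrable (measure_pmf (bernoulli_field B p)) G" for G :: "('a \<Rightarrow> bool) \<Rightarrow> 'b"
    by (rule integrable_bernoulli_field[OF B(3)])
  show ?thesis
    unfolding B(1) expectation_bernoulli_field_insert[OF B(3,2) p]
    by (simp add: scaleR_diff_right scaleR_diff_left algebra_simps)
qed

text \<open>The left side is the variance of \<open>F\<close>. Adding one variable turns the mean into \<open>p a + (1 - p) b\<close>, where
\<open>a\<close> and \<open>b\<close> are the two conditional means; the resulting loss of convexity is exactly
\<open>p (1 - p) |a - b|^2\<close>, the contribution of the new variable.\<close>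

lemma efron_stein_bernoulli_field:
  fixes F :: "('a \<Rightarrow> bool) \<Rightarrow> complex"
  assumes "finite A" and p: "0 \<le> p" "p \<le> 1"
    and "\<And>f e. e \<in> A \<Longrightarrow> cmod (F (f(e := True)) - F (f(e := False))) \<le> c" and "0 \<le> c"
  shows "measure_pmf.expectation (bernoulli_field A p) (\<lambda>f. (cmod (F f))\<^sup>2)
     - (cmod (measure_pmf.expectation (bernoulli_field A p) F))\<^sup>2 \<le> real (card A) * (p * (1 - p) * c\<^sup>2)"
  using assms(1,4)
proof (induction A arbitrary: F rule: finite_induct)
  case empty
  then show ?case by simp
next
  case (insert e A)
  let ?E = "measure_pmf.expectation (bernoulli_field A p)"
  define FT where "FT f = F (f(e := True))" for f
  define FF where "FF f = F (f(e := False))" for f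
  have int: "integrable (measure_pmf (bernoulli_field A p)) G" for G :: "('a \<Rightarrow> bool) \<Rightarrow> complex"
    by (rule integrable_bernoulli_field) fact
  have twist: "f(x := y, e := b) = f(e := b, x := y)" if "x \<in> A" for f :: "'a \<Rightarrow> bool" and x y b
    using that insert.hyps by (intro fun_upd_twist) auto
  have IT: "?E (\<lambda>f. (cmod (FT f))\<^sup>2) - (cmod (?E FT))\<^sup>2 \<le> real (card A) * (p * (1 - p) * c\<^sup>2)"
  proof (rule insert.IH)
    fix f x assume x: "x \<in> A"
    show "cmod (FT (f(x := True)) - FT (f(x := False))) \<le> c"
      unfolding FT_def twist[OF x] by (rule insert.prems) (use x in simp)
  qed
  have IF: "?E (\<lambda>f. (cmod (FF f))\<^sup>2) - (cmod (?E FF))\<^sup>2 \<le> real (card A) * (p * (1 - p) * c\<^sup>2)"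
  proof (rule insert.IH)
    fix f x assume x: "x \<in> A"
    show "cmod (FF (f(x := True)) - FF (f(x := False))) \<le> c"
      unfolding FF_def twist[OF x] by (rule insert.prems) (use x in simp)
  qed
  have "cmod (?E FT - ?E FF) = cmod (?E (\<lambda>f. FT f - FF f))"
    by (simp add: int)
  also have "\<dots> \<le> ?E (\<lambda>f. cmod (FT f - FF f))" by (rule integral_norm_bound)
  also have "\<dots> \<le> ?E (\<lambda>f. c)"
    unfolding FT_def FF_def by (intro integral_mono integrable_bernoulli_field insert.hyps insert.prems) simp
  finally have d: "(cmod (?E FT - ?E FF))\<^sup>2 \<le> c\<^sup>2" by (simp add: power_mono)
  have conv: "(cmod (p *\<^sub>R a + (1 - p) *\<^sub>R b))\<^sup>2 = p * (cmod a)\<^sup>2 + (1 - p) * (cmod b)\<^sup>2 - p * (1 - p) * (cmod (a - b))\<^sup>2"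
    for a b :: complex
    unfolding cmod_power2 by (simp add: power2_eq_square algebra_simps)
  have "p * ?E (\<lambda>f. (cmod (FT f))\<^sup>2) + (1 - p) * ?E (\<lambda>f. (cmod (FF f))\<^sup>2)
      - (p * (cmod (?E FT))\<^sup>2 + (1 - p) * (cmod (?E FF))\<^sup>2) \<le> real (card A) * (p * (1 - p) * c\<^sup>2)"
    using mult_left_mono[OF IT p(1)] mult_left_mono[OF IF, of "1 - p"] p by (simp add: algebra_simps)
  moreover have "p * (1 - p) * (cmod (?E FT - ?E FF))\<^sup>2 \<le> p * (1 - p) * c\<^sup>2"
    using d p by (intro mult_left_mono) auto
  ultimately show ?case
    unfolding expectation_bernoulli_field_insert[OF insert.hyps p] conv FT_def[symmetric] FF_def[symmetric]
    using insert.hyps by (simp add: algebra_simps)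
qed

section \<open>Resolvents of symmetric matrices\<close>

text \<open>One eigenbasis is chosen for each matrix, so that the eigenvalues of a random matrix become functions of the
underlying graph.\<close>

definition eigenvalues :: "nat \<Rightarrow> (nat \<Rightarrow> nat \<Rightarrow> real) \<Rightarrow> nat \<Rightarrow> real" where
  "eigenvalues n H = fst (SOME b. eigen_basis n H (fst b) (snd b))"

definition eigenvectors :: "nat \<Rightarrow> (nat \<Rightarrow> nat \<Rightarrow> real) \<Rightarrow> nat \<Rightarrow> nat \<Rightarrow> real" where
  "eigenvectors n H = snd (SOME b. eigen_basis n H (fst b) (snd b))"

text \<open>The matrix \<open>(H - i \<eta>)^{-1}\<close>, written out in an eigenbasis: its trace and its row norms can then be read
off from the spectrum.\<close>

definition resolvent :: "nat \<Rightarrow> (nat \<Rightarrow> nat \<Rightarrow> real) \<Rightarrow> real \<Rightarrow> nat \<Rightarrow> nat \<Rightarrow> complex" where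
  "resolvent n H \<eta> a b = (\<Sum>k<n. complex_of_real (eigenvectors n H k a * eigenvectors n H k b)
     / (complex_of_real (eigenvalues n H k) - \<i> * complex_of_real \<eta>))"

lemma eigen_basis_some:
  assumes "\<And>i j. i < n \<Longrightarrow> j < n \<Longrightarrow> H i j = H j i"
  shows "eigen_basis n H (eigenvalues n H) (eigenvectors n H)"
proof -
  obtain l u where "eigen_basis n H l u" using eigen_basis_exists[of n H] assms by blast
  then have "eigen_basis n H (fst (l, u)) (snd (l, u))" by simp
  then show ?thesis unfolding eigenvalues_def eigenvectors_def by (rule someI)
qed

lemma eigen_basis_eigenvector:
  assumes "eigen_basis n H l u" "k < n" "a < n"
  shows "(\<Sum>c<n. H a c * u k c) = l k * u k a"
proof -
  have "(\<Sum>c<n. H a c * u k c) = (\<Sum>c<n. \<Sum>m<n. l m * u m a * (u m c * u k c))"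
    using assms by (intro sum.cong refl) (simp add: eigen_basis_def sum_distrib_left mult_ac)
  also have "\<dots> = (\<Sum>m<n. l m * u m a * (\<Sum>c<n. u m c * u k c))"
    by (subst sum.swap) (simp add: sum_distrib_left)
  also have "\<dots> = (\<Sum>m<n. if m = k then l k * u k a else 0)"
  proof (rule sum.cong[OF refl])
    fix m assume "m \<in> {..<n}"
    then have "(\<Sum>c<n. u m c * u k c) = (if m = k then 1 else 0)"
      using assms by (simp add: eigen_basis_def)
    then show "l m * u m a * (\<Sum>c<n. u m c * u k c) = (if m = k then l k * u k a else 0)" by simp
  qed
  finally show ?thesis using assms by simp
qed

lemma resolvent_commute: "resolvent n H \<eta> a b = resolvent n H \<eta> b a"
  by (simp add: resolvent_def mult.commute)

lemma cmod_real_minus_imaginary: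
  assumes "\<eta> > 0"
  shows "cmod (complex_of_real x - \<i> * complex_of_real \<eta>) \<ge> \<eta>"
    "complex_of_real x - \<i> * complex_of_real \<eta> \<noteq> 0"
proof -
  have "Im (complex_of_real x - \<i> * complex_of_real \<eta>) = - \<eta>" by simp
  then show *: "cmod (complex_of_real x - \<i> * complex_of_real \<eta>) \<ge> \<eta>"
    by (metis abs_Im_le_cmod abs_minus_cancel abs_of_pos assms)
  show "complex_of_real x - \<i> * complex_of_real \<eta> \<noteq> 0" using * assms by auto
qed

lemma resolvent_eq:
  assumes sym: "\<And>i j. i < n \<Longrightarrow> j < n \<Longrightarrow> H i j = H j i" and \<eta>: "\<eta> > 0" and ab: "a < n" "b < n"
  shows "(\<Sum>c<n. complex_of_real (H a c) * resolvent n H \<eta> c b) =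
    (if a = b then 1 else 0) + \<i> * \<eta> * resolvent n H \<eta> a b"
proof -
  define l u where "l = eigenvalues n H" and "u = eigenvectors n H"
  have eb: "eigen_basis n H l u" using eigen_basis_some[OF sym] by (simp add: l_def u_def)
  define z where "z k = complex_of_real (l k) - \<i> * complex_of_real \<eta>" for k
  have z: "z k \<noteq> 0" for k using cmod_real_minus_imaginary[OF \<eta>] by (simp add: z_def)
  have G: "resolvent n H \<eta> c b = (\<Sum>k<n. complex_of_real (u k c * u k b) / z k)" for c
    by (simp add: resolvent_def l_def u_def z_def)
  have "(\<Sum>c<n. complex_of_real (H a c) * resolvent n H \<eta> c b) =
      (\<Sum>k<n. \<Sum>c<n. complex_of_real (H a c * u k c) * (complex_of_real (u k b) / z k))"
    unfolding G sum_distrib_left by (subst sum.swap) (simp add: mult_ac)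
  also have "\<dots> = (\<Sum>k<n. complex_of_real (l k * u k a) * (complex_of_real (u k b) / z k))"
    unfolding sum_distrib_right[symmetric] of_real_sum[symmetric]
    by (intro sum.cong refl) (simp add: eigen_basis_eigenvector[OF eb _ ab(1)] del: of_real_mult of_real_sum)
  also have "\<dots> = (\<Sum>k<n. complex_of_real (u k a * u k b)) + \<i> * \<eta> * resolvent n H \<eta> a b"
    unfolding G sum_distrib_left sum.distrib[symmetric]
  proof (intro sum.cong refl)
    fix k
    have "complex_of_real (l k) = z k + \<i> * \<eta>" by (simp add: z_def)
    then show "complex_of_real (l k * u k a) * (complex_of_real (u k b) / z k) =
        complex_of_real (u k a * u k b) + \<i> * \<eta> * (complex_of_real (u k a * u k b) / z k)"
      using z[of k] by (simp add: field_simps)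
  qed
  also have "(\<Sum>k<n. complex_of_real (u k a * u k b)) = (if a = b then 1 else 0)"
    using eb ab unfolding of_real_sum[symmetric] by (simp add: eigen_basis_def del: of_real_mult of_real_sum)
  finally show ?thesis .
qed

text \<open>By Parseval, since \<open>1 / |\<lambda> - i \<eta>| \<le> 1 / \<eta>\<close> for every real \<open>\<lambda>\<close>. The bound is the same for
every \<open>H\<close>, so all error terms below are controlled for each graph and not only for typical ones.\<close>

lemma resolvent_row_bound:
  assumes sym: "\<And>i j. i < n \<Longrightarrow> j < n \<Longrightarrow> H i j = H j i" and \<eta>: "\<eta> > 0" and a: "a < n"
  shows "(\<Sum>b<n. (cmod (resolvent n H \<eta> a b))\<^sup>2) \<le> 1 / \<eta>\<^sup>2"
proof -
  define l u where "l = eigenvalues n H" and "u = eigenvectors n H"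
  have eb: "eigen_basis n H l u" using eigen_basis_some[OF sym] by (simp add: l_def u_def)
  define c where "c k = complex_of_real (u k a) / (complex_of_real (l k) - \<i> * complex_of_real \<eta>)" for k
  have G: "resolvent n H \<eta> a b = (\<Sum>k<n. c k * complex_of_real (u k b))" for b
    by (simp add: resolvent_def l_def u_def c_def)
  have "(\<Sum>b<n. (cmod (resolvent n H \<eta> a b))\<^sup>2) =
      (\<Sum>b<n. (\<Sum>k<n. Re (c k) * u k b)\<^sup>2) + (\<Sum>b<n. (\<Sum>k<n. Im (c k) * u k b)\<^sup>2)"
    unfolding G cmod_power2 by (simp add: sum.distrib)
  also have "\<dots> = (\<Sum>k<n. (cmod (c k))\<^sup>2)"
    unfolding eigen_basis_parseval(2)[OF eb] by (simp add: cmod_power2 sum.distrib)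
  also have "\<dots> \<le> (\<Sum>k<n. u k a * u k a / \<eta>\<^sup>2)"
  proof (intro sum_mono)
    fix k
    have "(u k a)\<^sup>2 / (cmod (complex_of_real (l k) - \<i> * complex_of_real \<eta>))\<^sup>2 \<le> (u k a)\<^sup>2 / \<eta>\<^sup>2"
      using \<eta> cmod_real_minus_imaginary[OF \<eta>] by (intro divide_left_mono power_mono mult_pos_pos) auto
    then show "(cmod (c k))\<^sup>2 \<le> u k a * u k a / \<eta>\<^sup>2"
      by (simp add: c_def norm_divide power_divide power2_eq_square)
  qed
  also have "\<dots> = 1 / \<eta>\<^sup>2"
    using eb a by (simp add: eigen_basis_def flip: sum_divide_distrib)
  finally show ?thesis .
qed

lemma resolvent_entry_bound:
  assumes "\<And>i j. i < n \<Longrightarrow> j < n \<Longrightarrow> H i j = H j i" "\<eta> > 0" "a < n" "b < n"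
  shows "cmod (resolvent n H \<eta> a b) \<le> 1 / \<eta>"
proof -
  have "(cmod (resolvent n H \<eta> a b))\<^sup>2 \<le> (\<Sum>b<n. (cmod (resolvent n H \<eta> a b))\<^sup>2)"
    using assms(4) by (intro member_le_sum) auto
  also have "\<dots> \<le> (1 / \<eta>)\<^sup>2" using resolvent_row_bound[OF assms(1-3)] by (simp add: power_divide)
  finally show ?thesis using assms(2) by (simp add: power2_le_iff_abs_le)
qed

lemma sum_mult_cmod_le:
  assumes "(\<Sum>b<n. (cmod (x b))\<^sup>2) \<le> B" "(\<Sum>b<n. (cmod (y b))\<^sup>2) \<le> B"
  shows "cmod (\<Sum>b<n. x b * y b) \<le> B"
proof -
  have "cmod (\<Sum>b<n. x b * y b) \<le> (\<Sum>b<n. ((cmod (x b))\<^sup>2 + (cmod (y b))\<^sup>2) / 2)"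
  proof (rule sum_norm_le)
    fix b
    show "cmod (x b * y b) \<le> ((cmod (x b))\<^sup>2 + (cmod (y b))\<^sup>2) / 2"
      using sum_squares_bound[of "cmod (x b)" "cmod (y b)"] by (simp add: norm_mult)
  qed
  also have "\<dots> \<le> B" using assms by (simp add: sum.distrib flip: sum_divide_distrib)
  finally show ?thesis .
qed

lemma resolvent_trace:
  assumes "\<And>i j. i < n \<Longrightarrow> j < n \<Longrightarrow> H i j = H j i"
  shows "(\<Sum>a<n. resolvent n H \<eta> a a) =
    (\<Sum>k<n. 1 / (complex_of_real (eigenvalues n H k) - \<i> * complex_of_real \<eta>))"
proof -
  have eb: "eigen_basis n H (eigenvalues n H) (eigenvectors n H)" using eigen_basis_some[OF assms] .
  have "(\<Sum>a<n. resolvent n H \<eta> a a) = (\<Sum>k<n. complex_of_real (\<Sum>a<n. eigenvectors n H k a * eigenvectors n H k a)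
     / (complex_of_real (eigenvalues n H k) - \<i> * complex_of_real \<eta>))"
    unfolding resolvent_def of_real_sum sum_divide_distrib by (rule sum.swap)
  also have "\<dots> = (\<Sum>k<n. complex_of_real 1 / (complex_of_real (eigenvalues n H k) - \<i> * complex_of_real \<eta>))"
    using eb by (intro sum.cong refl arg_cong2[of _ _ _ _ "(/)"] arg_cong[of _ _ complex_of_real])
      (simp add: eigen_basis_def)
  finally show ?thesis by simp
qed

text \<open>The resolvent identity \<open>G' - G = G' (H - H') G\<close>, for a change of \<open>H\<close> in one symmetric pair of entries. The
proof evaluates \<open>G' H G\<close> and \<open>G' H' G\<close> from the defining equations of \<open>G\<close> and \<open>G'\<close>.\<close>

lemma resolvent_rank_two_perturbation:
  assumes sym: "\<And>i j. i < n \<Longrightarrow> j < n \<Longrightarrow> H i j = H j i"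
    and diff: "\<And>c d. c < n \<Longrightarrow> d < n \<Longrightarrow>
      H' c d = H c d + (if c = i \<and> d = j then t else 0) + (if c = j \<and> d = i then t else 0)"
    and ij: "i < n" "j < n" and \<eta>: "\<eta> > 0" and ab: "a < n" "b < n"
  shows "resolvent n H' \<eta> a b - resolvent n H \<eta> a b = - (complex_of_real t *
    (resolvent n H' \<eta> a i * resolvent n H \<eta> j b + resolvent n H' \<eta> a j * resolvent n H \<eta> i b))"
proof -
  let ?G = "resolvent n H \<eta>" and ?G' = "resolvent n H' \<eta>"
  have sym': "H' c d = H' d c" if "c < n" "d < n" for c d
    unfolding diff[OF that] diff[OF that(2,1)] sym[OF that] by (simp add: conj_commute)
  have "(\<Sum>c<n. ?G' a c * (\<Sum>d<n. complex_of_real (H c d) * ?G d b)) =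
      (\<Sum>c<n. ?G' a c * ((if c = b then 1 else 0) + \<i> * \<eta> * ?G c b))"
    by (rule sum.cong[OF refl]) (simp only: resolvent_eq[of n H \<eta> _ b, OF sym \<eta> _ ab(2)] lessThan_iff)
  also have "\<dots> = ?G' a b + (\<Sum>c<n. \<i> * \<eta> * ?G' a c * ?G c b)"
  proof -
    have "?G' a c * ((if c = b then 1 else 0) + \<i> * \<eta> * ?G c b) =
        (if c = b then ?G' a b else 0) + \<i> * \<eta> * ?G' a c * ?G c b" for c
      by (simp add: algebra_simps)
    then show ?thesis using ab by (simp add: sum.distrib)
  qed
  finally have 1: "(\<Sum>c<n. ?G' a c * (\<Sum>d<n. complex_of_real (H c d) * ?G d b)) = \<dots>" .
  have "(\<Sum>c<n. ?G' a c * (\<Sum>d<n. complex_of_real (H' c d) * ?G d b)) =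
      (\<Sum>d<n. (\<Sum>c<n. complex_of_real (H' d c) * ?G' c a) * ?G d b)"
  proof -
    have step: "?G' a c * (complex_of_real (H' c d) * ?G d b) = complex_of_real (H' d c) * ?G' c a * ?G d b"
      if "c < n" "d < n" for c d
      using sym'[OF that] resolvent_commute[of n H' \<eta> a c] by simp
    show ?thesis
      unfolding sum_distrib_left sum_distrib_right
      by (rule trans[OF sum.swap], rule sum.cong[OF refl], rule sum.cong[OF refl]) (simp only: step lessThan_iff)
  qed
  also have "\<dots> = (\<Sum>d<n. ((if d = a then 1 else 0) + \<i> * \<eta> * ?G' d a) * ?G d b)"
    by (rule sum.cong[OF refl]) (simp only: resolvent_eq[of n H' \<eta> _ a, OF sym' \<eta> _ ab(1)] lessThan_iff)
  also have "\<dots> = ?G a b + (\<Sum>c<n. \<i> * \<eta> * ?G' a c * ?G c b)"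
  proof -
    have "((if d = a then 1 else 0) + \<i> * \<eta> * ?G' d a) * ?G d b =
        (if d = a then ?G a b else 0) + \<i> * \<eta> * ?G' a d * ?G d b" for d
      using resolvent_commute[of n H' \<eta> a d] by (simp add: algebra_simps)
    then show ?thesis using ab by (simp add: sum.distrib)
  qed
  finally have 2: "(\<Sum>c<n. ?G' a c * (\<Sum>d<n. complex_of_real (H' c d) * ?G d b)) = \<dots>" .
  have *: "(\<Sum>d<n. complex_of_real (H' c d) * ?G d b) = (\<Sum>d<n. complex_of_real (H c d) * ?G d b)
      + (if c = i then t * ?G j b else 0) + (if c = j then t * ?G i b else 0)" if "c < n" for c
  proof -
    have "complex_of_real (H' c d) * ?G d b = complex_of_real (H c d) * ?G d b
        + (if d = j then if c = i then t * ?G j b else 0 else 0)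
        + (if d = i then if c = j then t * ?G i b else 0 else 0)" if "d < n" for d
      using diff[OF \<open>c < n\<close> that] by (simp add: algebra_simps)
    then show ?thesis using ij by (simp add: sum.distrib)
  qed
  have "(\<Sum>c<n. ?G' a c * (\<Sum>d<n. complex_of_real (H' c d) * ?G d b)) =
      (\<Sum>c<n. ?G' a c * (\<Sum>d<n. complex_of_real (H c d) * ?G d b)) + ?G' a i * (t * ?G j b) + ?G' a j * (t * ?G i b)"
  proof -
    have "?G' a c * (X + (if c = i then Y else 0) + (if c = j then Z else 0)) =
      ?G' a c * X + (if c = i then ?G' a i * Y else 0) + (if c = j then ?G' a j * Z else 0)" for c X Y Z
      by (simp add: algebra_simps)
    then show ?thesis using ij * by (simp add: sum.distrib)
  qed
  then show ?thesis using 1 2 by (simp add: algebra_simps)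
qed

section \<open>The Stieltjes transform of the centred adjacency matrix\<close>

text \<open>The factor \<open>1 / sqrt n\<close> keeps the spectrum bounded on average: the squared eigenvalues have mean at most
\<open>1\<close>. Here \<open>f\<close> is the indicator function of the edge set, and row \<open>i\<close> belongs to vertex \<open>Suc i\<close>.\<close>

definition wigner :: "nat \<Rightarrow> real \<Rightarrow> (nat set \<Rightarrow> bool) \<Rightarrow> nat \<Rightarrow> nat \<Rightarrow> real" where
  "wigner n p f i j = (if i = j then 0 else (of_bool (f {Suc i, Suc j}) - p) / sqrt (real n))"

definition stieltjes :: "nat \<Rightarrow> (nat \<Rightarrow> nat \<Rightarrow> real) \<Rightarrow> real \<Rightarrow> complex" where
  "stieltjes n H \<eta> = (\<Sum>a<n. resolvent n H \<eta> a a) / of_nat n"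

lemma wigner_commute: "wigner n p f i j = wigner n p f j i"
  by (simp add: wigner_def insert_commute)

lemma wigner_switch_edge:
  assumes "i \<noteq> j"
  shows "wigner n p (f({Suc i, Suc j} := True)) c d = wigner n p (f({Suc i, Suc j} := False)) c d
    + (if c = i \<and> d = j then 1 / sqrt (real n) else 0) + (if c = j \<and> d = i then 1 / sqrt (real n) else 0)"
proof -
  have "{Suc c, Suc d} = {Suc i, Suc j} \<longleftrightarrow> (c = i \<and> d = j) \<or> (c = j \<and> d = i)"
    by (auto simp: doubleton_eq_iff)
  then show ?thesis using assms by (auto simp: wigner_def diff_divide_distrib)
qed

lemma resolvent_wigner_switch_edge:
  assumes "i \<noteq> j" "i < n" "j < n" "\<eta> > 0" "a < n" "b < n"
  shows "resolvent n (wigner n p (f({Suc i, Suc j} := True))) \<eta> a b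
      - resolvent n (wigner n p (f({Suc i, Suc j} := False))) \<eta> a b =
    - (complex_of_real (1 / sqrt (real n)) *
      (resolvent n (wigner n p (f({Suc i, Suc j} := True))) \<eta> a i *
         resolvent n (wigner n p (f({Suc i, Suc j} := False))) \<eta> j b
     + resolvent n (wigner n p (f({Suc i, Suc j} := True))) \<eta> a j *
         resolvent n (wigner n p (f({Suc i, Suc j} := False))) \<eta> i b))"
proof (rule resolvent_rank_two_perturbation)
  show "wigner n p (f({Suc i, Suc j} := False)) c d = wigner n p (f({Suc i, Suc j} := False)) d c" for c d
    by (rule wigner_commute)
  show "wigner n p (f({Suc i, Suc j} := True)) c d = wigner n p (f({Suc i, Suc j} := False)) c d
      + (if c = i \<and> d = j then 1 / sqrt (real n) else 0) + (if c = j \<and> d = i then 1 / sqrt (real n) else 0)" for c d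
    by (rule wigner_switch_edge[OF assms(1)])
qed fact+

lemma resolvent_wigner_row_bound:
  assumes "\<eta> > 0" "a < n"
  shows "(\<Sum>b<n. (cmod (resolvent n (wigner n p f) \<eta> a b))\<^sup>2) \<le> 1 / \<eta>\<^sup>2"
proof (rule resolvent_row_bound)
  show "wigner n p f i j = wigner n p f j i" for i j by (rule wigner_commute)
qed fact+

lemma resolvent_wigner_bound:
  assumes "\<eta> > 0" "a < n" "b < n"
  shows "cmod (resolvent n (wigner n p f) \<eta> a b) \<le> 1 / \<eta>"
proof (rule resolvent_entry_bound)
  show "wigner n p f i j = wigner n p f j i" for i j by (rule wigner_commute)
qed fact+

lemma norm_mult_le_mult: "cmod x \<le> a \<Longrightarrow> cmod y \<le> b \<Longrightarrow> cmod (x * y) \<le> a * b"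
  unfolding norm_mult by (intro mult_mono) (auto intro: order_trans[OF norm_ge_zero])

lemma resolvent_wigner_switch_bound:
  assumes "i \<noteq> j" "i < n" "j < n" "\<eta> > 0" "a < n" "b < n"
  shows "cmod (resolvent n (wigner n p (f({Suc i, Suc j} := y))) \<eta> a b - resolvent n (wigner n p f) \<eta> a b)
    \<le> 2 / (\<eta>\<^sup>2 * sqrt (real n))"
proof -
  let ?G = "\<lambda>y. resolvent n (wigner n p (f({Suc i, Suc j} := y))) \<eta>"
  have "cmod (?G True a i * ?G False j b + ?G True a j * ?G False i b) \<le> 1 / \<eta> * (1 / \<eta>) + 1 / \<eta> * (1 / \<eta>)"
    using assms by (intro norm_triangle_le add_mono norm_mult_le_mult resolvent_wigner_bound) auto
  then have "cmod (complex_of_real (1 / sqrt (real n))) * cmod (?G True a i * ?G False j b + ?G True a j * ?G False i b)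
      \<le> 1 / sqrt (real n) * (2 / \<eta>\<^sup>2)"
    by (intro mult_mono) (auto simp: power2_eq_square norm_divide)
  then have TF: "cmod (?G True a b - ?G False a b) \<le> 2 / (\<eta>\<^sup>2 * sqrt (real n))"
    unfolding resolvent_wigner_switch_edge[OF assms] norm_minus_cancel norm_mult by (simp add: mult.commute)
  have "resolvent n (wigner n p f) \<eta> = ?G (f {Suc i, Suc j})" by simp
  then show ?thesis
    using TF norm_minus_commute[of "?G True a b" "?G False a b"] assms(4)
    by (cases y; cases "f {Suc i, Suc j}") auto
qed

lemma stieltjes_wigner_switch_bound:
  assumes "i \<noteq> j" "i < n" "j < n" "\<eta> > 0"
  shows "cmod (stieltjes n (wigner n p (f({Suc i, Suc j} := True))) \<eta>
      - stieltjes n (wigner n p (f({Suc i, Suc j} := False))) \<eta>) \<le> 2 / (\<eta>\<^sup>2 * (real n * sqrt (real n)))"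
proof -
  let ?G = "\<lambda>y. resolvent n (wigner n p (f({Suc i, Suc j} := y))) \<eta>"
  have b: "cmod (\<Sum>a<n. ?G True k a * ?G False m a) \<le> 1 / \<eta>\<^sup>2" if "k < n" "m < n" for k m
    using assms that by (intro sum_mult_cmod_le resolvent_wigner_row_bound) auto
  have "(\<Sum>a<n. ?G True a a) - (\<Sum>a<n. ?G False a a) =
      (\<Sum>a<n. - (complex_of_real (1 / sqrt (real n)) * (?G True i a * ?G False j a + ?G True j a * ?G False i a)))"
    unfolding sum_subtractf[symmetric]
    by (rule sum.cong[OF refl], subst resolvent_wigner_switch_edge[OF assms])
      (simp_all add: resolvent_commute[of _ _ _ _ i] resolvent_commute[of _ _ _ _ j])
  also have "\<dots> = - (complex_of_real (1 / sqrt (real n)) *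
      ((\<Sum>a<n. ?G True i a * ?G False j a) + (\<Sum>a<n. ?G True j a * ?G False i a)))"
    by (simp only: sum_negf flip: sum_distrib_left sum.distrib)
  finally have eq: "(\<Sum>a<n. ?G True a a) - (\<Sum>a<n. ?G False a a) = \<dots>" .
  have "cmod ((\<Sum>a<n. ?G True i a * ?G False j a) + (\<Sum>a<n. ?G True j a * ?G False i a)) \<le> 1 / \<eta>\<^sup>2 + 1 / \<eta>\<^sup>2"
    using assms by (intro norm_triangle_le add_mono b) auto
  then have "cmod (complex_of_real (1 / sqrt (real n))) *
      cmod ((\<Sum>a<n. ?G True i a * ?G False j a) + (\<Sum>a<n. ?G True j a * ?G False i a))
      \<le> 1 / sqrt (real n) * (2 / \<eta>\<^sup>2)"
    by (intro mult_mono) (auto simp: norm_divide)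
  then have "cmod ((\<Sum>a<n. ?G True a a) - (\<Sum>a<n. ?G False a a)) \<le> 1 / sqrt (real n) * (2 / \<eta>\<^sup>2)"
    unfolding eq norm_minus_cancel norm_mult .
  then have "cmod ((\<Sum>a<n. ?G True a a) - (\<Sum>a<n. ?G False a a)) / real n \<le> 1 / sqrt (real n) * (2 / \<eta>\<^sup>2) / real n"
    by (rule divide_right_mono) simp
  then show ?thesis
    by (simp add: stieltjes_def norm_divide mult_ac flip: diff_divide_distrib)
qed

lemma finite_vertex_pairs: "finite (vertex_pairs n)"
  by (rule finite_subset[of _ "Pow {1..n}"]) (auto simp: vertex_pairs_def)

lemma card_vertex_pairs_le: "real (card (vertex_pairs n)) \<le> (real n)\<^sup>2"
proof -
  have "card (vertex_pairs n) = n choose 2"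
    unfolding vertex_pairs_def using n_subsets[of "{1..n}" 2] by simp
  also have "\<dots> \<le> n ^ 2" by (cases "2 \<le> n") (auto intro: binomial_le_pow simp: binomial_eq_0)
  finally show ?thesis by (metis of_nat_le_iff of_nat_power)
qed

lemma mem_vertex_pairs: "i < n \<Longrightarrow> j < n \<Longrightarrow> i \<noteq> j \<Longrightarrow> {Suc i, Suc j} \<in> vertex_pairs n"
  by (auto simp: vertex_pairs_def)

lemma vertex_pairs_cases:
  assumes "e \<in> vertex_pairs n"
  obtains i j where "e = {Suc i, Suc j}" "i < n" "j < n" "i \<noteq> j"
proof -
  from assms obtain x y where xy: "e = {x, y}" "x \<noteq> y" "x \<in> {1..n}" "y \<in> {1..n}"
    by (auto simp: vertex_pairs_def card_2_iff)
  then show thesis using that[of "x - 1" "y - 1"] by auto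
qed


text \<open>The products that arise from integration by parts contain the resolvents with edge \<open>{a, c}\<close> switched on and
off. Replacing both by the resolvent of the given graph costs \<open>O(1 / sqrt n)\<close> for each pair. What remains is
the square of the trace, up to the terms \<open>G c a * G c a\<close>, whose row sums are bounded, and the diagonal.\<close>

lemma resolvent_product_switch_sum:
  fixes p :: real and f :: "nat set \<Rightarrow> bool"
  assumes \<eta>: "\<eta> > 0" and n: "n > 0"
  defines "G \<equiv> \<lambda>f. resolvent n (wigner n p f) \<eta>"
  shows "cmod ((\<Sum>a<n. \<Sum>c<n. if a = c then 0 else
        G (f({Suc a, Suc c} := True)) c a * G (f({Suc a, Suc c} := False)) c a
      + G (f({Suc a, Suc c} := True)) c c * G (f({Suc a, Suc c} := False)) a a)
      - (\<Sum>a<n. G f a a)\<^sup>2) \<le> 8 * (real n)\<^sup>2 / (\<eta> ^ 3 * sqrt (real n)) + 3 * real n / \<eta>\<^sup>2"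
proof -
  define s where "s = sqrt (real n)"
  have s: "s > 0" using n by (simp add: s_def)
  define X where "X a c = (if a = c then 0 else
        G (f({Suc a, Suc c} := True)) c a * G (f({Suc a, Suc c} := False)) c a
      + G (f({Suc a, Suc c} := True)) c c * G (f({Suc a, Suc c} := False)) a a)" for a c
  define Y where "Y a c = (if a = c then 0 else G f c a * G f c a + G f c c * G f a a)" for a c
  have prod: "cmod (x * y - x' * y') \<le> 4 / (\<eta> ^ 3 * s)"
    if "cmod (x - x') \<le> 2 / (\<eta>\<^sup>2 * s)" "cmod (y - y') \<le> 2 / (\<eta>\<^sup>2 * s)" "cmod x' \<le> 1 / \<eta>" "cmod y \<le> 1 / \<eta>"
    for x y x' y'
  proof -
    have "x * y - x' * y' = (x - x') * y + x' * (y - y')" by (simp add: algebra_simps)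
    also have "cmod \<dots> \<le> 2 / (\<eta>\<^sup>2 * s) * (1 / \<eta>) + 1 / \<eta> * (2 / (\<eta>\<^sup>2 * s))"
      by (intro norm_triangle_le add_mono norm_mult_le_mult that)
    also have "\<dots> = 4 / (\<eta> ^ 3 * s)" by (simp add: power2_eq_square power3_eq_cube mult_ac)
    finally show ?thesis .
  qed
  have XY: "cmod (X a c - Y a c) \<le> 8 / (\<eta> ^ 3 * s)" if ac: "a < n" "c < n" for a c
  proof (cases "a = c")
    case True
    then show ?thesis using \<eta> s by (simp add: X_def Y_def)
  next
    case False
    let ?T = "G (f({Suc a, Suc c} := True))" and ?F = "G (f({Suc a, Suc c} := False))"
    have d: "cmod (?T x y - G f x y) \<le> 2 / (\<eta>\<^sup>2 * s)" "cmod (?F x y - G f x y) \<le> 2 / (\<eta>\<^sup>2 * s)"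
      if "x < n" "y < n" for x y
      unfolding G_def s_def using False ac \<eta> that by (auto intro: resolvent_wigner_switch_bound)
    have b: "cmod (G g x y) \<le> 1 / \<eta>" if "x < n" "y < n" for g x y
      unfolding G_def using \<eta> that by (rule resolvent_wigner_bound)
    have "X a c - Y a c = (?T c a * ?F c a - G f c a * G f c a) + (?T c c * ?F a a - G f c c * G f a a)"
      using False by (simp add: X_def Y_def)
    also have "cmod \<dots> \<le> 4 / (\<eta> ^ 3 * s) + 4 / (\<eta> ^ 3 * s)"
      by (intro norm_triangle_le add_mono prod d b ac)
    finally show ?thesis by (simp add: mult.commute)
  qed
  have sumXY: "cmod ((\<Sum>a<n. \<Sum>c<n. X a c) - (\<Sum>a<n. \<Sum>c<n. Y a c)) \<le> (\<Sum>a<n. \<Sum>c<n. 8 / (\<eta> ^ 3 * s))"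
  proof -
    have "cmod (\<Sum>a<n. \<Sum>c<n. X a c - Y a c) \<le> (\<Sum>a<n. \<Sum>c<n. 8 / (\<eta> ^ 3 * s))"
      by (rule sum_norm_le, rule sum_norm_le, rule XY) simp_all
    then show ?thesis by (simp only: sum_subtractf)
  qed
  have row: "cmod (\<Sum>c<n. G f a c * G f a c) \<le> 1 / \<eta>\<^sup>2" if "a < n" for a
    unfolding G_def using \<eta> that by (intro sum_mult_cmod_le resolvent_wigner_row_bound) auto
  have Y: "(\<Sum>a<n. \<Sum>c<n. Y a c) - (\<Sum>a<n. G f a a)\<^sup>2 =
      (\<Sum>a<n. (\<Sum>c<n. G f a c * G f a c) - 2 * (G f a a * G f a a))"
  proof -
    have "Y a c = G f a c * G f a c + G f a a * G f c c - (if c = a then 2 * (G f a a * G f a a) else 0)" for a c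
      by (auto simp: Y_def G_def resolvent_commute[of _ _ _ c a])
    then have "(\<Sum>a<n. \<Sum>c<n. Y a c) = (\<Sum>a<n. (\<Sum>c<n. G f a c * G f a c) - 2 * (G f a a * G f a a))
        + (\<Sum>a<n. \<Sum>c<n. G f a a * G f c c)"
      by (simp add: sum.distrib sum_subtractf)
    then show ?thesis by (simp add: power2_eq_square sum_product)
  qed
  have "cmod (\<Sum>a<n. (\<Sum>c<n. G f a c * G f a c) - 2 * (G f a a * G f a a)) \<le> (\<Sum>a<n. 3 / \<eta>\<^sup>2)"
  proof (rule sum_norm_le)
    fix a assume "a \<in> {..<n}"
    then have a: "a < n" by simp
    have "cmod (G f a a * G f a a) \<le> 1 / \<eta> * (1 / \<eta>)"
      unfolding G_def using \<eta> a by (intro norm_mult_le_mult resolvent_wigner_bound)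
    then have "cmod (2 * (G f a a * G f a a)) \<le> 2 / \<eta>\<^sup>2" by (simp add: norm_mult power2_eq_square)
    then have "cmod ((\<Sum>c<n. G f a c * G f a c) - 2 * (G f a a * G f a a)) \<le> 1 / \<eta>\<^sup>2 + 2 / \<eta>\<^sup>2"
      using row[OF a] by (intro norm_triangle_le_diff add_mono)
    then show "cmod ((\<Sum>c<n. G f a c * G f a c) - 2 * (G f a a * G f a a)) \<le> 3 / \<eta>\<^sup>2" by simp
  qed
  then have "cmod ((\<Sum>a<n. \<Sum>c<n. Y a c) - (\<Sum>a<n. G f a a)\<^sup>2) \<le> 3 * real n / \<eta>\<^sup>2"
    unfolding Y by (simp add: mult.commute)
  from norm_triangle_mono[OF sumXY this] have "cmod (((\<Sum>a<n. \<Sum>c<n. X a c) - (\<Sum>a<n. \<Sum>c<n. Y a c)) + ((\<Sum>a<n. \<Sum>c<n. Y a c) - (\<Sum>a<n. G f a a)\<^sup>2))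
      \<le> (\<Sum>a<n. \<Sum>c<n. 8 / (\<eta> ^ 3 * s)) + 3 * real n / \<eta>\<^sup>2"
    .
  then show ?thesis unfolding X_def s_def by (simp add: power2_eq_square mult_ac)
qed

lemma expectation_wigner_resolvent:
  assumes p: "0 \<le> p" "p \<le> 1" and \<eta>: "\<eta> > 0" and ac: "a < n" "c < n"
  defines "G \<equiv> \<lambda>f. resolvent n (wigner n p f) \<eta>"
    and "E \<equiv> measure_pmf.expectation (bernoulli_field (vertex_pairs n) p)"
  shows "E (\<lambda>f. complex_of_real (wigner n p f a c) * G f c a) =
    - (complex_of_real (p * (1 - p) / real n)) * E (\<lambda>f. if a = c then 0 else
        G (f({Suc a, Suc c} := True)) c a * G (f({Suc a, Suc c} := False)) c a
      + G (f({Suc a, Suc c} := True)) c c * G (f({Suc a, Suc c} := False)) a a)"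
proof (cases "a = c")
  case True
  then show ?thesis by (simp add: wigner_def E_def)
next
  case False
  define e where "e = {Suc a, Suc c}"
  define s where "s = complex_of_real (sqrt (real n))"
  have ss: "s * s = of_nat n" by (simp add: s_def flip: of_real_mult)
  have e: "e \<in> vertex_pairs n" unfolding e_def using ac False by (rule mem_vertex_pairs)
  have "E (\<lambda>f. complex_of_real (wigner n p f a c) * G f c a) =
      E (\<lambda>f. (of_bool (f e) - p) *\<^sub>R (G f c a / s))"
    using False by (simp add: wigner_def e_def s_def scaleR_conv_of_real)
  also have "\<dots> = (p * (1 - p)) *\<^sub>R E (\<lambda>f. G (f(e := True)) c a / s - G (f(e := False)) c a / s)"
    unfolding E_def by (rule expectation_centered_bernoulli_mult[OF finite_vertex_pairs e p])
  also have "(\<lambda>f. G (f(e := True)) c a / s - G (f(e := False)) c a / s) =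
      (\<lambda>f. (- 1 / of_nat n) * (G (f(e := True)) c a * G (f(e := False)) c a + G (f(e := True)) c c * G (f(e := False)) a a))"
  proof
    fix f
    have "G (f(e := True)) c a - G (f(e := False)) c a =
        - (1 / s * (G (f(e := True)) c a * G (f(e := False)) c a + G (f(e := True)) c c * G (f(e := False)) a a))"
      unfolding G_def e_def s_def using resolvent_wigner_switch_edge[OF False ac \<eta> ac(2,1)] by simp
    then show "G (f(e := True)) c a / s - G (f(e := False)) c a / s =
      (- 1 / of_nat n) * (G (f(e := True)) c a * G (f(e := False)) c a + G (f(e := True)) c c * G (f(e := False)) a a)"
      by (simp add: diff_divide_distrib[symmetric] ss[symmetric])
  qed
  finally show ?thesis
    using False by (simp add: E_def e_def scaleR_conv_of_real)
qed


text \<open>The approximate self-consistent equation: take expectations in the trace of \<open>H G = 1 + i \<eta> G\<close>, divided by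
\<open>n\<close>, and evaluate \<open>E (H G)\<close> entry by entry through integration by parts.\<close>

lemma expectation_trace_wigner_resolvent:
  assumes p: "0 \<le> p" "p \<le> 1" and \<eta>: "\<eta> > 0" and n: "n > 0"
  defines "S \<equiv> \<lambda>f. stieltjes n (wigner n p f) \<eta>"
    and "E \<equiv> measure_pmf.expectation (bernoulli_field (vertex_pairs n) p)"
  shows "cmod (1 + \<i> * \<eta> * E S + complex_of_real (p * (1 - p)) * E (\<lambda>f. (S f)\<^sup>2))
    \<le> (8 / \<eta> ^ 3 + 3 / \<eta>\<^sup>2) / sqrt (real n)"
proof -
  let ?V = "bernoulli_field (vertex_pairs n) p"
  define v where "v = complex_of_real (p * (1 - p))"
  have v: "cmod v \<le> 1"
    using p mult_le_one[of p "1 - p"] unfolding v_def norm_of_real by (simp add: abs_mult)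
  define N where "N = (of_nat n :: complex)"
  have N: "N \<noteq> 0" "cmod N = real n" using n by (simp_all add: N_def)
  define G where "G f = resolvent n (wigner n p f) \<eta>" for f
  define X where "X f = (\<Sum>a<n. \<Sum>c<n. if a = c then 0 else
        G (f({Suc a, Suc c} := True)) c a * G (f({Suc a, Suc c} := False)) c a
      + G (f({Suc a, Suc c} := True)) c c * G (f({Suc a, Suc c} := False)) a a)" for f
  have int: "integrable (measure_pmf ?V) F" for F :: "(nat set \<Rightarrow> bool) \<Rightarrow> complex"
    by (rule integrable_bernoulli_field[OF finite_vertex_pairs])
  have intr: "integrable (measure_pmf ?V) F" for F :: "(nat set \<Rightarrow> bool) \<Rightarrow> real"
    by (rule integrable_bernoulli_field[OF finite_vertex_pairs])
  have tr: "(\<Sum>a<n. G f a a) = N * S f" for f using n by (simp add: S_def stieltjes_def G_def N_def)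
  have "(\<Sum>c<n. complex_of_real (wigner n p f a c) * G f c a) = 1 + \<i> * \<eta> * G f a a" if "a < n" for f a
    unfolding G_def using resolvent_eq[of n "wigner n p f" \<eta> a a, OF wigner_commute \<eta> that that] by simp
  then have "(\<Sum>a<n. \<Sum>c<n. complex_of_real (wigner n p f a c) * G f c a) = N + \<i> * \<eta> * (N * S f)" for f
    by (simp add: sum.distrib N_def tr[unfolded N_def, symmetric] flip: sum_distrib_left)
  then have "N + \<i> * \<eta> * (N * E S) = E (\<lambda>f. \<Sum>a<n. \<Sum>c<n. complex_of_real (wigner n p f a c) * G f c a)"
    using int by (simp add: E_def)
  also have "\<dots> = (\<Sum>a<n. \<Sum>c<n. E (\<lambda>f. complex_of_real (wigner n p f a c) * G f c a))"
    using int by (simp add: E_def)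
  also have "\<dots> = (\<Sum>a<n. \<Sum>c<n. - (complex_of_real (p * (1 - p) / real n)) * E (\<lambda>f. if a = c then 0 else
        G (f({Suc a, Suc c} := True)) c a * G (f({Suc a, Suc c} := False)) c a
      + G (f({Suc a, Suc c} := True)) c c * G (f({Suc a, Suc c} := False)) a a))"
    unfolding E_def G_def
    by (rule sum.cong[OF refl], rule sum.cong[OF refl], rule expectation_wigner_resolvent[OF p \<eta>]) simp_all
  also have "\<dots> = - (complex_of_real (p * (1 - p) / real n)) * E X"
    using int unfolding X_def E_def by (simp only: sum_distrib_left[symmetric] Bochner_Integration.integral_sum)
  also have "complex_of_real (p * (1 - p) / real n) = v / N" by (simp add: v_def N_def)
  finally have eq: "N + \<i> * \<eta> * (N * E S) = - (v / N) * E X" .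
  define B where "B = 8 * (real n)\<^sup>2 / (\<eta> ^ 3 * sqrt (real n)) + 3 * real n / \<eta>\<^sup>2"
  have XS: "cmod (X f - (N * S f)\<^sup>2) \<le> B" for f
    unfolding X_def B_def tr[symmetric] unfolding G_def by (rule resolvent_product_switch_sum[OF \<eta> n])
  have "cmod (E (\<lambda>f. X f - (N * S f)\<^sup>2)) \<le> measure_pmf.expectation ?V (\<lambda>f. cmod (X f - (N * S f)\<^sup>2))"
    unfolding E_def by (rule integral_norm_bound)
  also have "\<dots> \<le> measure_pmf.expectation ?V (\<lambda>f. B)"
    by (intro integral_mono intr) (rule XS)
  finally have "cmod (E (\<lambda>f. X f - (N * S f)\<^sup>2)) \<le> B" by simp
  also have "E (\<lambda>f. X f - (N * S f)\<^sup>2) = E X - N\<^sup>2 * E (\<lambda>f. (S f)\<^sup>2)"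
    using int by (simp add: E_def power_mult_distrib)
  finally have XB: "cmod (E X - N\<^sup>2 * E (\<lambda>f. (S f)\<^sup>2)) \<le> B" .
  have "1 + \<i> * \<eta> * E S + v * E (\<lambda>f. (S f)\<^sup>2) = (N + \<i> * \<eta> * (N * E S)) / N + v * E (\<lambda>f. (S f)\<^sup>2)"
    using N by (simp add: field_simps)
  also have "\<dots> = - v * (E X - N\<^sup>2 * E (\<lambda>f. (S f)\<^sup>2)) / N\<^sup>2"
    unfolding eq using N by (simp add: field_simps power2_eq_square)
  finally have "cmod (1 + \<i> * \<eta> * E S + v * E (\<lambda>f. (S f)\<^sup>2)) =
      cmod v * cmod (E X - N\<^sup>2 * E (\<lambda>f. (S f)\<^sup>2)) / (real n)\<^sup>2"
    by (simp add: norm_mult norm_divide norm_power N)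
  also have "\<dots> \<le> 1 * B / (real n)\<^sup>2"
    using v XB by (intro divide_right_mono mult_mono) auto
  also have "\<dots> = 8 / (\<eta> ^ 3 * sqrt (real n)) + 3 / (\<eta>\<^sup>2 * real n)"
    using n \<eta> by (simp add: B_def add_divide_distrib power2_eq_square)
  also have "\<dots> \<le> 8 / (\<eta> ^ 3 * sqrt (real n)) + 3 / (\<eta>\<^sup>2 * sqrt (real n))"
  proof -
    have "sqrt (real n) \<le> real n" using n by (intro real_le_lsqrt) (auto simp: power2_eq_square)
    then show ?thesis using n \<eta> by (intro add_left_mono divide_left_mono mult_left_mono mult_pos_pos) auto
  qed
  also have "\<dots> = (8 / \<eta> ^ 3 + 3 / \<eta>\<^sup>2) / sqrt (real n)" by (simp add: add_divide_distrib)
  finally show ?thesis by (simp add: v_def)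
qed

text \<open>There are at most \<open>n^2\<close> pairs of vertices, and each changes the transform by \<open>O(1 / (n sqrt n))\<close>.\<close>

lemma variance_stieltjes_wigner:
  assumes p: "0 \<le> p" "p \<le> 1" and \<eta>: "\<eta> > 0" and n: "n > 0"
  defines "S \<equiv> \<lambda>f. stieltjes n (wigner n p f) \<eta>"
    and "V \<equiv> bernoulli_field (vertex_pairs n) p"
  shows "measure_pmf.expectation V (\<lambda>f. (cmod (S f))\<^sup>2) - (cmod (measure_pmf.expectation V S))\<^sup>2
    \<le> 4 / (\<eta> ^ 4 * real n)"
proof -
  define c where "c = 2 / (\<eta>\<^sup>2 * (real n * sqrt (real n)))"
  have "measure_pmf.expectation V (\<lambda>f. (cmod (S f))\<^sup>2) - (cmod (measure_pmf.expectation V S))\<^sup>2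
      \<le> real (card (vertex_pairs n)) * (p * (1 - p) * c\<^sup>2)"
    unfolding V_def
  proof (rule efron_stein_bernoulli_field[OF finite_vertex_pairs p])
    fix f e assume "e \<in> vertex_pairs n"
    then obtain i j where "e = {Suc i, Suc j}" "i < n" "j < n" "i \<noteq> j" by (rule vertex_pairs_cases)
    then show "cmod (S (f(e := True)) - S (f(e := False))) \<le> c"
      unfolding S_def c_def using \<eta> by (auto intro: stieltjes_wigner_switch_bound)
  qed (simp add: c_def)
  also have "\<dots> \<le> (real n)\<^sup>2 * (1 * c\<^sup>2)"
    using p by (intro mult_mono card_vertex_pairs_le mult_le_one) auto
  also have "\<dots> = 4 / (\<eta> ^ 4 * real n)"
    using n by (simp add: c_def power_divide power_mult_distrib flip: power_mult)
  finally show ?thesis .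
qed

text \<open>The imaginary part, at the point \<open>i \<eta>\<close>, of the Stieltjes transform of the semicircle law of variance \<open>v\<close>. It is
the positive root of \<open>v g^2 + \<eta> g = 1\<close>.\<close>

definition semicircle_stieltjes :: "real \<Rightarrow> real \<Rightarrow> real" where
  "semicircle_stieltjes v \<eta> = (sqrt (\<eta>\<^sup>2 + 4 * v) - \<eta>) / (2 * v)"

lemma semicircle_stieltjes_eq:
  assumes "v > 0"
  shows "v * (semicircle_stieltjes v \<eta>)\<^sup>2 + \<eta> * semicircle_stieltjes v \<eta> = 1"
proof -
  define r where "r = sqrt (\<eta>\<^sup>2 + 4 * v)"
  have r: "r\<^sup>2 = \<eta>\<^sup>2 + 4 * v" using assms by (simp add: r_def)
  have "v * ((r - \<eta>) / (2 * v))\<^sup>2 + \<eta> * ((r - \<eta>) / (2 * v)) = (r\<^sup>2 - \<eta>\<^sup>2) / (4 * v)"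
    using assms by (simp add: field_simps power2_eq_square)
  also have "\<dots> = 1" using r assms by simp
  finally show ?thesis by (simp add: semicircle_stieltjes_def r_def)
qed

lemma semicircle_stieltjes_nonneg:
  assumes "v > 0" shows "semicircle_stieltjes v \<eta> \<ge> 0"
proof -
  have "\<eta> \<le> sqrt (\<eta>\<^sup>2 + 4 * v)" using assms by (intro real_le_rsqrt) simp
  then show ?thesis using assms by (simp add: semicircle_stieltjes_def)
qed

text \<open>With \<open>g\<close> the exact solution, the quadratic at \<open>m\<close> factors as \<open>(m - i g) (v (m + i g) + i \<eta>)\<close>. The imaginary
part of the second factor is at least \<open>\<eta>\<close>, because \<open>Im m\<close> and \<open>g\<close> are nonnegative.\<close>

lemma quadratic_equation_stable:
  fixes m :: complex
  assumes "v > 0" "\<eta> > 0" "Im m \<ge> 0"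
  shows "cmod (m - \<i> * semicircle_stieltjes v \<eta>) \<le> cmod (1 + \<i> * \<eta> * m + v * m\<^sup>2) / \<eta>"
proof -
  define g where "g = semicircle_stieltjes v \<eta>"
  have g: "g \<ge> 0" using assms by (simp add: g_def semicircle_stieltjes_nonneg)
  have "complex_of_real (v * g\<^sup>2 + \<eta> * g) = 1" using semicircle_stieltjes_eq[OF assms(1)] by (simp add: g_def)
  then have one: "1 = v * (complex_of_real g)\<^sup>2 + \<eta> * g" by simp
  have "(1 :: complex) + \<i> * \<eta> * m + v * m\<^sup>2 = (m - \<i> * g) * (v * (m + \<i> * g) + \<i> * \<eta>)"
    by (subst one) (simp add: algebra_simps power2_eq_square)
  then have eq: "cmod (1 + \<i> * \<eta> * m + v * m\<^sup>2) = cmod (m - \<i> * g) * cmod (v * (m + \<i> * g) + \<i> * \<eta>)"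
    by (simp add: norm_mult)
  have "\<eta> \<le> Im (v * (m + \<i> * g) + \<i> * \<eta>)" using assms g by simp
  also have "\<dots> \<le> cmod (v * (m + \<i> * g) + \<i> * \<eta>)" using abs_Im_le_cmod[of "v * (m + \<i> * g) + \<i> * \<eta>"] by linarith
  finally have "cmod (m - \<i> * g) * \<eta> \<le> cmod (1 + \<i> * \<eta> * m + v * m\<^sup>2)"
    unfolding eq by (intro mult_left_mono) auto
  then show ?thesis using assms by (simp add: g_def pos_le_divide_eq)
qed

lemma Im_stieltjes:
  assumes "\<And>i j. i < n \<Longrightarrow> j < n \<Longrightarrow> H i j = H j i"
  shows "Im (stieltjes n H \<eta>) = (\<Sum>k<n. \<eta> / ((eigenvalues n H k)\<^sup>2 + \<eta>\<^sup>2)) / real n"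
proof -
  have "Im (1 / (complex_of_real x - \<i> * complex_of_real \<eta>)) = \<eta> / (x\<^sup>2 + \<eta>\<^sup>2)" for x
    by (simp add: Im_divide)
  then show ?thesis
    using resolvent_trace[of n H \<eta>, OF assms] by (simp add: stieltjes_def)
qed

theorem stieltjes_wigner_convergence:
  assumes p: "0 < p" "p < 1" and \<eta>: "\<eta> > 0"
  obtains K where "\<And>n. n > 0 \<Longrightarrow> measure_pmf.expectation (bernoulli_field (vertex_pairs n) p)
    (\<lambda>f. \<bar>Im (stieltjes n (wigner n p f) \<eta>) - semicircle_stieltjes (p * (1 - p)) \<eta>\<bar>) \<le> K / sqrt (real n)"
proof -
  define v where "v = p * (1 - p)"
  have v: "0 < v" "v \<le> 1" using p mult_le_one[of p "1 - p"] by (auto simp: v_def)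
  define K1 where "K1 = 8 / \<eta> ^ 3 + 3 / \<eta>\<^sup>2"
  define K2 where "K2 = 4 / \<eta> ^ 4"
  define g where "g = semicircle_stieltjes v \<eta>"
  have K2: "K2 \<ge> 0" by (simp add: K2_def)
  show thesis
  proof (rule that)
    fix n :: nat assume n: "n > 0"
    let ?V = "bernoulli_field (vertex_pairs n) p"
    define S where "S = (\<lambda>f. stieltjes n (wigner n p f) \<eta>)"
    define m where "m = measure_pmf.expectation ?V S"
    define q where "q = 1 / sqrt (real n)"
    have q: "q > 0" "q * q = 1 / real n" "q \<le> 1" using n by (auto simp: q_def)
    have int: "integrable (measure_pmf ?V) F" for F :: "(nat set \<Rightarrow> bool) \<Rightarrow> complex"
      by (rule integrable_bernoulli_field[OF finite_vertex_pairs])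
    have intr: "integrable (measure_pmf ?V) F" for F :: "(nat set \<Rightarrow> bool) \<Rightarrow> real"
      by (rule integrable_bernoulli_field[OF finite_vertex_pairs])
    have p': "0 \<le> p" "p \<le> 1" using p by auto
    have Im_S: "Im (S f) \<ge> 0" for f
      unfolding S_def by (subst Im_stieltjes) (use \<eta> in \<open>auto intro!: wigner_commute divide_nonneg_nonneg sum_nonneg\<close>)
    have Im_m: "Im m = measure_pmf.expectation ?V (\<lambda>f. Im (S f))"
      unfolding m_def by (simp add: int)
    have m0: "Im m \<ge> 0" unfolding Im_m by (rule Bochner_Integration.integral_nonneg) (rule Im_S)
    have "measure_pmf.expectation ?V (\<lambda>f. (cmod (S f - m))\<^sup>2) =
        measure_pmf.expectation ?V (\<lambda>f. (cmod (S f))\<^sup>2 - 2 * (Re m * Re (S f) + Im m * Im (S f)) + (cmod m)\<^sup>2)"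
      by (intro arg_cong[of _ _ "measure_pmf.expectation ?V"] ext, unfold cmod_power2) (simp add: power2_eq_square algebra_simps)
    also have "\<dots> = measure_pmf.expectation ?V (\<lambda>f. (cmod (S f))\<^sup>2)
        - 2 * (Re m * measure_pmf.expectation ?V (\<lambda>f. Re (S f)) + Im m * measure_pmf.expectation ?V (\<lambda>f. Im (S f))) + (cmod m)\<^sup>2"
      by (simp add: intr)
    also have "measure_pmf.expectation ?V (\<lambda>f. Re (S f)) = Re m" unfolding m_def by (simp add: int)
    also have "measure_pmf.expectation ?V (\<lambda>f. Im (S f)) = Im m" by (simp add: Im_m)
    also have "measure_pmf.expectation ?V (\<lambda>f. (cmod (S f))\<^sup>2) - 2 * (Re m * Re m + Im m * Im m) + (cmod m)\<^sup>2
        = measure_pmf.expectation ?V (\<lambda>f. (cmod (S f))\<^sup>2) - (cmod m)\<^sup>2"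
      unfolding cmod_power2 by (simp add: power2_eq_square)
    also have "\<dots> \<le> 4 / (\<eta> ^ 4 * real n)"
      unfolding m_def S_def by (rule variance_stieltjes_wigner[OF p' \<eta> n])
    also have "\<dots> = K2 * (q * q)" by (simp add: K2_def q)
    finally have var: "measure_pmf.expectation ?V (\<lambda>f. (cmod (S f - m))\<^sup>2) \<le> K2 * (q * q)" .
    \<comment> \<open>The variance is of order \<open>q^2\<close>; comparing \<open>|S - m|\<close> with \<open>q\<close> by the inequality of the means gives a first moment of order \<open>q\<close>.\<close>
    have "measure_pmf.expectation ?V (\<lambda>f. cmod (S f - m)) \<le>
        measure_pmf.expectation ?V (\<lambda>f. q / 2 + (cmod (S f - m))\<^sup>2 / (2 * q))"
    proof (intro integral_mono intr)
      fix f
      have "2 * q * cmod (S f - m) \<le> q\<^sup>2 + (cmod (S f - m))\<^sup>2" by (rule sum_squares_bound)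
      then show "cmod (S f - m) \<le> q / 2 + (cmod (S f - m))\<^sup>2 / (2 * q)"
        using q(1) by (simp add: field_simps power2_eq_square)
    qed
    also have "\<dots> = q / 2 + measure_pmf.expectation ?V (\<lambda>f. (cmod (S f - m))\<^sup>2) / (2 * q)"
      by (simp add: intr)
    also have "\<dots> \<le> q / 2 + K2 * (q * q) / (2 * q)"
      using var q by (intro add_left_mono divide_right_mono) auto
    also have "\<dots> = (1 + K2) / 2 * q" using q(1) by (simp add: field_simps)
    finally have L1: "measure_pmf.expectation ?V (\<lambda>f. cmod (S f - m)) \<le> (1 + K2) / 2 * q" .
    have "measure_pmf.expectation ?V (\<lambda>f. (S f - m)\<^sup>2) =
        measure_pmf.expectation ?V (\<lambda>f. (S f)\<^sup>2 - 2 * m * S f + m\<^sup>2)"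
      by (rule Bochner_Integration.integral_cong[OF refl]) (simp add: power2_diff mult_ac)
    also have "\<dots> = measure_pmf.expectation ?V (\<lambda>f. (S f)\<^sup>2) - 2 * m * m + m\<^sup>2"
      by (simp add: int m_def)
    also have "\<dots> = measure_pmf.expectation ?V (\<lambda>f. (S f)\<^sup>2) - m\<^sup>2" by (simp add: power2_eq_square)
    finally have "cmod (measure_pmf.expectation ?V (\<lambda>f. (S f)\<^sup>2) - m\<^sup>2) = cmod (measure_pmf.expectation ?V (\<lambda>f. (S f - m)\<^sup>2))" by simp
    also have "\<dots> \<le> measure_pmf.expectation ?V (\<lambda>f. cmod ((S f - m)\<^sup>2))" by (rule integral_norm_bound)
    also have "\<dots> \<le> K2 * (q * q)" using var by (simp add: norm_power)
    also have "\<dots> \<le> K2 * q" using q(1,3) K2 by (intro mult_left_mono mult_left_le_one_le) auto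
    finally have sq: "cmod (measure_pmf.expectation ?V (\<lambda>f. (S f)\<^sup>2) - m\<^sup>2) \<le> K2 * q" .
    let ?Q = "1 + \<i> * \<eta> * m + complex_of_real v * measure_pmf.expectation ?V (\<lambda>f. (S f)\<^sup>2)"
    have Q: "cmod ?Q \<le> K1 * q"
      using expectation_trace_wigner_resolvent[OF p' \<eta> n] unfolding m_def S_def v_def K1_def q_def by simp
    have "cmod (complex_of_real v * (measure_pmf.expectation ?V (\<lambda>f. (S f)\<^sup>2) - m\<^sup>2)) \<le> 1 * (K2 * q)"
      by (rule norm_mult_le_mult[OF _ sq]) (use v in simp)
    then have "cmod (?Q - complex_of_real v * (measure_pmf.expectation ?V (\<lambda>f. (S f)\<^sup>2) - m\<^sup>2)) \<le> K1 * q + K2 * q"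
      using norm_triangle_ineq4[of ?Q "complex_of_real v * (measure_pmf.expectation ?V (\<lambda>f. (S f)\<^sup>2) - m\<^sup>2)"] Q
      by linarith
    also have "?Q - complex_of_real v * (measure_pmf.expectation ?V (\<lambda>f. (S f)\<^sup>2) - m\<^sup>2) = 1 + \<i> * \<eta> * m + v * m\<^sup>2"
      by (simp add: algebra_simps)
    finally have "cmod (1 + \<i> * \<eta> * m + v * m\<^sup>2) / \<eta> \<le> (K1 * q + K2 * q) / \<eta>"
      using \<eta> by (intro divide_right_mono) auto
    with quadratic_equation_stable[OF v(1) \<eta> m0]
    have mg: "cmod (m - \<i> * g) \<le> (K1 * q + K2 * q) / \<eta>" unfolding g_def by (rule order_trans)
    have "measure_pmf.expectation ?V (\<lambda>f. \<bar>Im (S f) - g\<bar>) \<le>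
        measure_pmf.expectation ?V (\<lambda>f. cmod (S f - m) + cmod (m - \<i> * g))"
    proof (intro integral_mono intr)
      fix f
      have "\<bar>Im (S f) - g\<bar> = \<bar>Im ((S f - m) + (m - \<i> * g))\<bar>" by simp
      also have "\<dots> \<le> cmod ((S f - m) + (m - \<i> * g))" by (rule abs_Im_le_cmod)
      also have "\<dots> \<le> cmod (S f - m) + cmod (m - \<i> * g)" by (rule norm_triangle_ineq)
      finally show "\<bar>Im (S f) - g\<bar> \<le> cmod (S f - m) + cmod (m - \<i> * g)" .
    qed
    also have "\<dots> = measure_pmf.expectation ?V (\<lambda>f. cmod (S f - m)) + cmod (m - \<i> * g)"
      by (simp add: intr)
    also have "\<dots> \<le> (1 + K2) / 2 * q + (K1 * q + K2 * q) / \<eta>" by (intro add_mono L1 mg)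
    also have "\<dots> = ((1 + K2) / 2 + (K1 + K2) / \<eta>) / sqrt (real n)"
      by (simp add: q_def add_divide_distrib mult.commute)
    finally show "measure_pmf.expectation ?V (\<lambda>f. \<bar>Im (stieltjes n (wigner n p f) \<eta>)
        - semicircle_stieltjes (p * (1 - p)) \<eta>\<bar>) \<le> ((1 + K2) / 2 + (K1 + K2) / \<eta>) / sqrt (real n)"
      by (simp add: S_def g_def v_def)
  qed
qed

section \<open>From the Stieltjes transform to the energy\<close>

abbreviation half_line :: "real measure" where
  "half_line \<equiv> restrict_space lborel {0<..}"

lemma half_line_FTC_nonneg:
  fixes f F :: "real \<Rightarrow> real"
  assumes "\<And>t. t > 0 \<Longrightarrow> (F has_real_derivative f t) (at t)" "\<And>t. t > 0 \<Longrightarrow> isCont f t"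
    and "\<And>t. t > 0 \<Longrightarrow> f t \<ge> 0" "(F \<longlongrightarrow> A) (at_right 0)" "(F \<longlongrightarrow> B) at_top"
  shows "integrable half_line f" "integral\<^sup>L half_line f = B - A"
proof -
  have 0: "einterval 0 \<infinity> = {0<..}" by (auto simp: einterval_def zero_ereal_def)
  have lims: "((F \<circ> real_of_ereal) \<longlongrightarrow> A) (at_right 0)" "((F \<circ> real_of_ereal) \<longlongrightarrow> B) (at_left \<infinity>)"
    using assms(4,5) by (auto simp: zero_ereal_def ereal_tendsto_simps)
  have ftc: "set_integrable lborel (einterval 0 \<infinity>) f" "(LBINT t=0..\<infinity>. f t) = B - A"
    by (rule interval_integral_FTC_nonneg[OF _ _ _ _ lims]; use assms in \<open>force simp: zero_ereal_def\<close>)+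
  show "integrable half_line f"
    using ftc(1) by (simp add: 0 set_integrable_def integrable_restrict_space)
  show "integral\<^sup>L half_line f = B - A"
    using ftc(2) by (simp add: interval_lebesgue_integral_def 0 set_lebesgue_integral_def integral_restrict_space)
qed

lemma half_line_cauchy_kernel:
  shows "integrable half_line (\<lambda>t. x\<^sup>2 / (x\<^sup>2 + t\<^sup>2))" "integral\<^sup>L half_line (\<lambda>t. x\<^sup>2 / (x\<^sup>2 + t\<^sup>2)) = pi / 2 * \<bar>x\<bar>"
proof -
  have pos: "integrable half_line (\<lambda>t. y\<^sup>2 / (y\<^sup>2 + t\<^sup>2)) \<and> integral\<^sup>L half_line (\<lambda>t. y\<^sup>2 / (y\<^sup>2 + t\<^sup>2)) = pi / 2 * y"
    if y: "y > 0" for y :: real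
  proof -
    let ?F = "\<lambda>t. y * arctan (t / y)"
    have "(?F has_real_derivative y\<^sup>2 / (y\<^sup>2 + t\<^sup>2)) (at t)" for t
      using y by (auto intro!: derivative_eq_intros simp: field_simps power2_eq_square)
    moreover have "isCont (\<lambda>t. y\<^sup>2 / (y\<^sup>2 + t\<^sup>2)) t" for t
      using y by (intro continuous_intros) (auto simp: sum_power2_eq_zero_iff)
    moreover have "(?F \<longlongrightarrow> 0) (at_right 0)" using y by real_asymp
    moreover have "(?F \<longlongrightarrow> pi / 2 * y) at_top" using y by real_asymp
    ultimately show ?thesis
      using half_line_FTC_nonneg[of ?F "\<lambda>t. y\<^sup>2 / (y\<^sup>2 + t\<^sup>2)" 0 "pi / 2 * y"] by simp
  qed
  have "integrable half_line (\<lambda>t. x\<^sup>2 / (x\<^sup>2 + t\<^sup>2)) \<and> integral\<^sup>L half_line (\<lambda>t. x\<^sup>2 / (x\<^sup>2 + t\<^sup>2)) = pi / 2 * \<bar>x\<bar>"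
    using pos[of "\<bar>x\<bar>"] by (cases "x = 0") auto
  then show "integrable half_line (\<lambda>t. x\<^sup>2 / (x\<^sup>2 + t\<^sup>2))" "integral\<^sup>L half_line (\<lambda>t. x\<^sup>2 / (x\<^sup>2 + t\<^sup>2)) = pi / 2 * \<bar>x\<bar>"
    by auto
qed

lemma half_line_semicircle:
  assumes v: "v > 0"
  shows "integrable half_line (\<lambda>t. 1 - t * semicircle_stieltjes v t)"
    "integral\<^sup>L half_line (\<lambda>t. 1 - t * semicircle_stieltjes v t) = 4 / 3 * sqrt v"
proof -
  define s where "s t = sqrt (t\<^sup>2 + 4 * v)" for t
  have s: "s t > 0" "s t * s t = t\<^sup>2 + 4 * v" for t
    using v by (auto simp: s_def intro!: add_nonneg_pos)
  \<comment> \<open>The integrand is \<open>1 + t^2 / (2 v) - t s(t) / (2 v)\<close>, and \<open>s^3 / 3\<close> is an antiderivative of \<open>t s(t)\<close>.\<close>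
  let ?F = "\<lambda>t. t + t ^ 3 / (6 * v) - (s t) ^ 3 / (6 * v)"
  have ds: "(s has_real_derivative t / s t) (at t)" for t
  proof -
    have "t\<^sup>2 + 4 * v > 0" using v by (simp add: add_nonneg_pos)
    then show ?thesis unfolding s_def by (auto intro!: derivative_eq_intros simp: field_simps)
  qed
  have dF: "(?F has_real_derivative 1 - t * semicircle_stieltjes v t) (at t)" for t
  proof -
    have "(?F has_real_derivative 1 + 3 * t ^ 2 / (6 * v) - 3 * (s t) ^ 2 * (t / s t) / (6 * v)) (at t)"
      using v by (auto intro!: derivative_eq_intros ds)
    also have "1 + 3 * t ^ 2 / (6 * v) - 3 * (s t) ^ 2 * (t / s t) / (6 * v) = 1 - t * semicircle_stieltjes v t"
    proof -
      have ss: "semicircle_stieltjes v t = (s t - t) / (2 * v)" by (simp add: semicircle_stieltjes_def s_def)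
      show ?thesis unfolding ss using v s(1)[of t] by (simp add: field_simps power2_eq_square)
    qed
    finally show ?thesis .
  qed
  have nonneg: "1 - t * semicircle_stieltjes v t \<ge> 0" for t
  proof -
    have "1 - t * semicircle_stieltjes v t = v * (semicircle_stieltjes v t)\<^sup>2"
      using semicircle_stieltjes_eq[OF v, of t] by simp
    then show ?thesis using v by simp
  qed
  have cont: "isCont (\<lambda>t. 1 - t * semicircle_stieltjes v t) t" for t
    unfolding semicircle_stieltjes_def using v by (intro continuous_intros) auto
  have "(?F \<longlongrightarrow> ?F 0) (at_right 0)"
    using DERIV_isCont[OF dF[of 0]] unfolding isCont_def by (rule filterlim_mono[OF _ order_refl]) (simp add: at_le)
  moreover have "?F 0 = - (4 / 3 * sqrt v)"
  proof -
    have "(s 0) ^ 3 = 8 * (v * sqrt v)" using v by (simp add: s_def real_sqrt_mult power3_eq_cube)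
    then show ?thesis using v by simp
  qed
  ultimately have lim0: "(?F \<longlongrightarrow> - (4 / 3 * sqrt v)) (at_right 0)" by (simp only:)
  have liminf: "(?F \<longlongrightarrow> 0) at_top" unfolding s_def using v by real_asymp
  show "integrable half_line (\<lambda>t. 1 - t * semicircle_stieltjes v t)"
    "integral\<^sup>L half_line (\<lambda>t. 1 - t * semicircle_stieltjes v t) = 4 / 3 * sqrt v"
    using half_line_FTC_nonneg[OF dF cont nonneg lim0 liminf] by simp_all
qed

lemma sum_eigenvalues_squared:
  assumes "eigen_basis n H l u"
  shows "(\<Sum>k<n. (l k)\<^sup>2) = (\<Sum>i<n. \<Sum>j<n. (H i j)\<^sup>2)"
proof -
  have "(\<Sum>i<n. \<Sum>j<n. H i j * H i j) = (\<Sum>k<n. l k * (\<Sum>m<n. l m * (\<Sum>i<n. u k i * u m i)\<^sup>2))"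
    by (rule frobenius_product_spectral) (use assms in \<open>auto simp: eigen_basis_def\<close>)
  also have "\<dots> = (\<Sum>k<n. l k * (\<Sum>m<n. if m = k then l k else 0))"
  proof (rule sum.cong[OF refl], rule arg_cong2[of _ _ _ _ "(*)"], rule refl, rule sum.cong[OF refl])
    fix k m assume "k \<in> {..<n}" "m \<in> {..<n}"
    then have "(\<Sum>i<n. u k i * u m i) = (if k = m then 1 else 0)" using assms by (simp add: eigen_basis_def)
    then show "l m * (\<Sum>i<n. u k i * u m i)\<^sup>2 = (if m = k then l k else 0)" by simp
  qed
  finally show ?thesis by (simp add: power2_eq_square)
qed

lemma sum_eigenvalues_wigner_squared:
  assumes "0 \<le> p" "p \<le> 1"
  shows "(\<Sum>k<n. (eigenvalues n (wigner n p f) k)\<^sup>2) \<le> real n"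
proof -
  have "(wigner n p f i j)\<^sup>2 \<le> 1 / real n" for i j
  proof -
    have "(of_bool (f {Suc i, Suc j}) - p)\<^sup>2 \<le> 1"
      using assms by (cases "f {Suc i, Suc j}") (auto simp: abs_square_le_1)
    then show ?thesis by (simp add: wigner_def power_divide divide_right_mono)
  qed
  then have "(\<Sum>i<n. \<Sum>j<n. (wigner n p f i j)\<^sup>2) \<le> (\<Sum>i<n. \<Sum>j<n. 1 / real n)"
    by (intro sum_mono)
  also have "\<dots> = real n" by simp
  finally show ?thesis
    using sum_eigenvalues_squared[OF eigen_basis_some[of n "wigner n p f", OF wigner_commute]] by simp
qed

lemma tendsto_zero_divide_sqrt: "(\<lambda>n. K / sqrt (real n)) \<longlonglongrightarrow> 0"
  by real_asymp

text \<open>Both the mean of the \<open>|\<lambda>|\<close> and its limit are integrals over \<open>t > 0\<close>, of \<open>h\<close> and \<open>h0\<close> below. For fixed \<open>t\<close>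
the expected difference of the integrands tends to \<open>0\<close> by the convergence of the Stieltjes transform.
Both integrands lie between \<open>0\<close> and the minimum of \<open>1\<close> and \<open>1 / t^2\<close>, uniformly in \<open>n\<close> and in the graph,
so dominated convergence applies. Expectations are finite sums here and commute with the integral.\<close>

theorem wigner_energy_convergence:
  assumes p: "0 < p" "p < 1"
  shows "(\<lambda>n. measure_pmf.expectation (bernoulli_field (vertex_pairs n) p)
    (\<lambda>f. \<bar>(\<Sum>k<n. \<bar>eigenvalues n (wigner n p f) k\<bar>) / real n - 8 / (3 * pi) * sqrt (p * (1 - p))\<bar>)) \<longlonglongrightarrow> 0"
proof -
  define v where "v = p * (1 - p)"
  have v: "0 < v" "v \<le> 1" using p mult_le_one[of p "1 - p"] by (auto simp: v_def)
  define V where "V n = bernoulli_field (vertex_pairs n) p" for n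
  define l where "l n f k = eigenvalues n (wigner n p f) k" for n f k
  define h where "h n f t = (\<Sum>k<n. (l n f k)\<^sup>2 / ((l n f k)\<^sup>2 + t\<^sup>2)) / real n" for n f and t :: real
  define h0 where "h0 t = 1 - t * semicircle_stieltjes v t" for t
  define D where "D n t = measure_pmf.expectation (V n) (\<lambda>f. \<bar>h n f t - h0 t\<bar>)" for n t
  have fin: "finite (set_pmf (V n))" for n
    unfolding V_def by (rule finite_set_bernoulli_field[OF finite_vertex_pairs])
  have E: "measure_pmf.expectation (V n) F = (\<Sum>f\<in>set_pmf (V n). pmf (V n) f * F f)" for n and F :: "_ \<Rightarrow> real"
    by (subst integral_measure_pmf[OF fin]) auto
  have intV: "integrable (measure_pmf (V n)) F" for n and F :: "_ \<Rightarrow> real"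
    by (rule integrable_measure_pmf_finite[OF fin])
  have int_h: "integrable half_line (h n f)" for n f
    unfolding h_def by (intro integrable_divide_zero Bochner_Integration.integrable_sum half_line_cauchy_kernel(1))
  have I_h: "integral\<^sup>L half_line (h n f) = pi / 2 * ((\<Sum>k<n. \<bar>l n f k\<bar>) / real n)" for n f
    unfolding h_def by (simp add: half_line_cauchy_kernel sum_distrib_left)
  have int_h0: "integrable half_line h0" and I_h0: "integral\<^sup>L half_line h0 = 4 / 3 * sqrt v"
    using half_line_semicircle[OF v(1)] by (simp_all add: h0_def[abs_def])
  have h_bounds: "0 \<le> h n f t" "h n f t \<le> 1" "h n f t \<le> 1 / t\<^sup>2" if t: "t > 0" for n f t
  proof -
    show "0 \<le> h n f t" unfolding h_def by (intro divide_nonneg_nonneg sum_nonneg) auto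
    have "(\<Sum>k<n. (l n f k)\<^sup>2 / ((l n f k)\<^sup>2 + t\<^sup>2)) \<le> (\<Sum>k<n. 1)"
      using t by (intro sum_mono) (simp add: divide_le_eq_1 add_nonneg_pos)
    then show "h n f t \<le> 1" by (cases "n = 0") (auto simp: h_def divide_le_eq_1)
    have "(\<Sum>k<n. (l n f k)\<^sup>2 / ((l n f k)\<^sup>2 + t\<^sup>2)) \<le> (\<Sum>k<n. (l n f k)\<^sup>2 / t\<^sup>2)"
      using t by (intro sum_mono divide_left_mono) (auto simp: add_nonneg_pos)
    also have "\<dots> \<le> real n / t\<^sup>2"
      unfolding sum_divide_distrib[symmetric] l_def
      using p by (intro divide_right_mono sum_eigenvalues_wigner_squared) auto
    finally have "h n f t \<le> real n / t\<^sup>2 / real n" unfolding h_def by (rule divide_right_mono) simp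
    also have "\<dots> \<le> 1 / t\<^sup>2" by simp
    finally show "h n f t \<le> 1 / t\<^sup>2" .
  qed
  have h0_bounds: "0 \<le> h0 t" "h0 t \<le> 1" "h0 t \<le> 1 / t\<^sup>2" if t: "t > 0" for t
  proof -
    define g where "g = semicircle_stieltjes v t"
    have g: "g \<ge> 0" "v * g\<^sup>2 + t * g = 1"
      using semicircle_stieltjes_nonneg[OF v(1)] semicircle_stieltjes_eq[OF v(1)] by (auto simp: g_def)
    have eq: "h0 t = v * g\<^sup>2" using g(2) by (simp add: h0_def g_def)
    show "0 \<le> h0 t" using v by (simp add: eq)
    show "h0 t \<le> 1" using g t by (simp add: h0_def flip: g_def)
    have "t * g \<le> 1" using g(2) v by (smt (verit) mult_nonneg_nonneg zero_le_power2)
    then have "g\<^sup>2 \<le> (1 / t)\<^sup>2" using g(1) t by (intro power_mono) (auto simp: field_simps)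
    then have "v * g\<^sup>2 \<le> 1 * (1 / t)\<^sup>2" using v by (intro mult_mono) auto
    then show "h0 t \<le> 1 / t\<^sup>2" by (simp add: eq power_divide)
  qed
  have diff_bound: "\<bar>h n f t - h0 t\<bar> \<le> 2 * (1 / (1 + t\<^sup>2))" if t: "t > 0" for n f t
  proof -
    have 1: "\<bar>h n f t - h0 t\<bar> \<le> 1" and 2: "\<bar>h n f t - h0 t\<bar> \<le> 1 / t\<^sup>2"
      using h_bounds[OF t, of n f] h0_bounds[OF t] by linarith+
    have "\<bar>h n f t - h0 t\<bar> * t\<^sup>2 \<le> 1" using 2 t by (simp add: pos_le_divide_eq)
    with 1 have "\<bar>h n f t - h0 t\<bar> * (1 + t\<^sup>2) \<le> 2" by (simp add: distrib_left)
    then show ?thesis by (simp add: pos_le_divide_eq add_pos_nonneg)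
  qed
  have D_nonneg: "D n t \<ge> 0" for n t unfolding D_def by (rule Bochner_Integration.integral_nonneg) simp
  have D_bound: "D n t \<le> 2 * (1 / (1 + t\<^sup>2))" if t: "t > 0" for n t
  proof -
    have "D n t \<le> measure_pmf.expectation (V n) (\<lambda>_. 2 * (1 / (1 + t\<^sup>2)))"
      unfolding D_def by (intro integral_mono intV) (rule diff_bound[OF t])
    then show ?thesis by simp
  qed
  have D_lim: "(\<lambda>n. D n t) \<longlonglongrightarrow> 0" if t: "t > 0" for t
  proof -
    obtain K where K: "\<And>n. n > 0 \<Longrightarrow> measure_pmf.expectation (bernoulli_field (vertex_pairs n) p)
      (\<lambda>f. \<bar>Im (stieltjes n (wigner n p f) t) - semicircle_stieltjes (p * (1 - p)) t\<bar>) \<le> K / sqrt (real n)"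
      using stieltjes_wigner_convergence[OF p t] by blast
    have Dle: "D n t \<le> t * K / sqrt (real n)" if n: "n > 0" for n
    proof -
      have "h n f t = 1 - t * Im (stieltjes n (wigner n p f) t)" for f
      proof -
        have "t * (\<Sum>k<n. t / ((l n f k)\<^sup>2 + t\<^sup>2)) = (\<Sum>k<n. 1 - (l n f k)\<^sup>2 / ((l n f k)\<^sup>2 + t\<^sup>2))"
          unfolding sum_distrib_left
        proof (rule sum.cong[OF refl])
          fix k
          have "(l n f k)\<^sup>2 + t\<^sup>2 > 0" using t by (simp add: add_nonneg_pos)
          then have "1 - (l n f k)\<^sup>2 / ((l n f k)\<^sup>2 + t\<^sup>2) = ((l n f k)\<^sup>2 + t\<^sup>2 - (l n f k)\<^sup>2) / ((l n f k)\<^sup>2 + t\<^sup>2)"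
            unfolding diff_divide_distrib using t by simp
          then show "t * (t / ((l n f k)\<^sup>2 + t\<^sup>2)) = 1 - (l n f k)\<^sup>2 / ((l n f k)\<^sup>2 + t\<^sup>2)"
            by (simp add: power2_eq_square)
        qed
        also have "\<dots> = real n - real n * h n f t" using n by (simp add: sum_subtractf h_def)
        finally have eq: "t * (\<Sum>k<n. t / ((l n f k)\<^sup>2 + t\<^sup>2)) = real n - real n * h n f t" .
        have "Im (stieltjes n (wigner n p f) t) = (\<Sum>k<n. t / ((l n f k)\<^sup>2 + t\<^sup>2)) / real n"
          unfolding l_def by (rule Im_stieltjes) (rule wigner_commute)
        then have "t * Im (stieltjes n (wigner n p f) t) = (real n - real n * h n f t) / real n"
          by (simp add: eq)
        then show ?thesis using n by (simp add: diff_divide_distrib)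
      qed
      then have "\<bar>h n f t - h0 t\<bar> = t * \<bar>Im (stieltjes n (wigner n p f) t) - semicircle_stieltjes v t\<bar>" for f
        using t by (simp add: h0_def abs_mult abs_minus_commute flip: right_diff_distrib)
      then have "D n t = t * measure_pmf.expectation (V n) (\<lambda>f. \<bar>Im (stieltjes n (wigner n p f) t) - semicircle_stieltjes v t\<bar>)"
        unfolding D_def by simp
      also have "\<dots> \<le> t * (K / sqrt (real n))"
        using t K[OF n] by (intro mult_left_mono) (auto simp: V_def v_def)
      finally show ?thesis by simp
    qed
    have "\<forall>\<^sub>F n in sequentially. D n t \<le> t * K / sqrt (real n)"
      by (rule eventually_mono[OF eventually_gt_at_top[of 0] Dle])
    then show ?thesis
      using D_nonneg by (intro tendsto_sandwich[OF _ _ tendsto_const tendsto_zero_divide_sqrt]) auto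
  qed
  have meas_h: "(\<lambda>t. \<bar>h n f t - h0 t\<bar>) \<in> borel_measurable half_line" for n f
    using int_h int_h0 by (intro borel_measurable_abs borel_measurable_diff borel_measurable_integrable)
  have int_w: "integrable half_line (\<lambda>t. 2 * (1 / (1 + t\<^sup>2)))"
    using half_line_cauchy_kernel(1)[of 1] by (intro integrable_mult_right) simp
  have "(\<lambda>n. integral\<^sup>L half_line (D n)) \<longlonglongrightarrow> integral\<^sup>L half_line (\<lambda>t. 0)"
  proof (rule integral_dominated_convergence[OF _ _ int_w])
    show "D n \<in> borel_measurable half_line" for n
      unfolding D_def E by (intro borel_measurable_sum borel_measurable_times borel_measurable_const meas_h)
    show "AE t in half_line. (\<lambda>n. D n t) \<longlonglongrightarrow> 0"
      by (rule AE_I2) (simp add: D_lim)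
    show "AE t in half_line. norm (D n t) \<le> 2 * (1 / (1 + t\<^sup>2))" for n
      by (rule AE_I2) (use D_bound D_nonneg in \<open>simp add: \<close>)
  qed simp
  then have lim: "(\<lambda>n. 2 / pi * integral\<^sup>L half_line (D n)) \<longlonglongrightarrow> 0"
    by (auto intro: tendsto_mult_right_zero)
  have le: "measure_pmf.expectation (V n) (\<lambda>f. \<bar>(\<Sum>k<n. \<bar>l n f k\<bar>) / real n - 8 / (3 * pi) * sqrt v\<bar>)
      \<le> 2 / pi * integral\<^sup>L half_line (D n)" for n
  proof -
    have int_d: "integrable half_line (\<lambda>t. \<bar>h n f t - h0 t\<bar>)" for f
      by (intro integrable_abs Bochner_Integration.integrable_diff int_h int_h0)
    have "\<bar>(\<Sum>k<n. \<bar>l n f k\<bar>) / real n - 8 / (3 * pi) * sqrt v\<bar> \<le> 2 / pi * integral\<^sup>L half_line (\<lambda>t. \<bar>h n f t - h0 t\<bar>)" for f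
    proof -
      have "(\<Sum>k<n. \<bar>l n f k\<bar>) / real n - 8 / (3 * pi) * sqrt v = 2 / pi * (integral\<^sup>L half_line (h n f) - integral\<^sup>L half_line h0)"
        by (simp add: I_h I_h0 field_simps)
      also have "integral\<^sup>L half_line (h n f) - integral\<^sup>L half_line h0 = integral\<^sup>L half_line (\<lambda>t. h n f t - h0 t)"
        by (simp add: int_h int_h0)
      finally have "\<bar>(\<Sum>k<n. \<bar>l n f k\<bar>) / real n - 8 / (3 * pi) * sqrt v\<bar> = 2 / pi * \<bar>integral\<^sup>L half_line (\<lambda>t. h n f t - h0 t)\<bar>"
        by (simp add: abs_mult)
      also have "\<dots> \<le> 2 / pi * integral\<^sup>L half_line (\<lambda>t. \<bar>h n f t - h0 t\<bar>)"
        by (intro mult_left_mono integral_abs_bound) simp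
      finally show ?thesis .
    qed
    then have "measure_pmf.expectation (V n) (\<lambda>f. \<bar>(\<Sum>k<n. \<bar>l n f k\<bar>) / real n - 8 / (3 * pi) * sqrt v\<bar>)
        \<le> measure_pmf.expectation (V n) (\<lambda>f. 2 / pi * integral\<^sup>L half_line (\<lambda>t. \<bar>h n f t - h0 t\<bar>))"
      by (intro integral_mono intV)
    also have "\<dots> = 2 / pi * integral\<^sup>L half_line (D n)"
      unfolding D_def E using int_d by (simp add: sum_distrib_left mult_ac)
    finally show ?thesis .
  qed
  have "(\<lambda>n. measure_pmf.expectation (V n) (\<lambda>f. \<bar>(\<Sum>k<n. \<bar>l n f k\<bar>) / real n - 8 / (3 * pi) * sqrt v\<bar>)) \<longlonglongrightarrow> 0"
    by (rule tendsto_sandwich[OF _ _ tendsto_const lim]) (use le in \<open>auto intro!: always_eventually Bochner_Integration.integral_nonneg\<close>)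
  then show ?thesis by (simp add: V_def l_def v_def)
qed

section \<open>Concentration of the degrees\<close>

lemma degree_distribution:
  assumes p: "0 \<le> p" "p \<le> 1" and i: "i \<in> {1..n}"
  shows "map_pmf (\<lambda>f. degree_of {e \<in> vertex_pairs n. f e} i) (bernoulli_field (vertex_pairs n) p) = binomial_pmf (n - 1) p"
proof -
  define A where "A = {e \<in> vertex_pairs n. i \<in> e}"
  have "A = (\<lambda>j. {i, j}) ` ({1..n} - {i})"
  proof
    show "A \<subseteq> (\<lambda>j. {i, j}) ` ({1..n} - {i})"
    proof
      fix e assume "e \<in> A"
      then have e: "e \<subseteq> {1..n}" "card e = 2" "i \<in> e" by (auto simp: A_def vertex_pairs_def)
      then obtain j where "e = {i, j}" "j \<noteq> i"
        by (metis card_2_iff doubleton_eq_iff insertE insert_commute singletonD)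
      then show "e \<in> (\<lambda>j. {i, j}) ` ({1..n} - {i})" using e by auto
    qed
  qed (use i in \<open>auto simp: A_def vertex_pairs_def\<close>)
  moreover have "inj_on (\<lambda>j. {i, j}) ({1..n} - {i})" by (auto simp: inj_on_def doubleton_eq_iff)
  ultimately have card: "card A = n - 1" using i by (simp add: card_image)
  have A: "A \<subseteq> vertex_pairs n" by (auto simp: A_def)
  have fin: "finite A" by (rule finite_subset[OF A finite_vertex_pairs])
  have "binomial_pmf (n - 1) p = map_pmf (\<lambda>f. card {x \<in> A. f x}) (bernoulli_field A p)"
    using p by (intro binomial_pmf_altdef' fin card) auto
  also have "bernoulli_field A p = map_pmf (\<lambda>f x. if x \<in> A then f x else False) (bernoulli_field (vertex_pairs n) p)"
    by (rule Pi_pmf_subset[OF finite_vertex_pairs A])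
  finally show ?thesis
    by (simp add: pmf.map_comp o_def degree_of_def A_def conj_commute conj_left_commute cong: conj_cong)
qed

lemma degree_deviation:
  assumes p: "0 < p" "p < 1" and \<theta>: "0 < \<theta>" and n: "n > 1" "real n * \<theta> \<ge> 2" and i: "i \<in> {1..n}"
  shows "measure_pmf.prob (bernoulli_field (vertex_pairs n) p)
      {f. \<bar>real (degree_of {e \<in> vertex_pairs n. f e} i) / (real n * p) - 1\<bar> > \<theta>}
    \<le> 2 * exp (- (real (n - 1) * (\<theta> * p)\<^sup>2 / 2))"
proof -
  interpret B: binomial_distribution "n - 1" p by unfold_locales (use p in auto)
  \<comment> \<open>Half of the allowed deviation \<open>\<theta> p\<close> goes to Hoeffding, the other half absorbs the shift of the mean from \<open>(n - 1) p\<close> to \<open>n p\<close>.\<close>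
  define c where "c = \<theta> * p / 2"
  have c: "c > 0" using \<theta> p by (simp add: c_def)
  have "{f. \<bar>real (degree_of {e \<in> vertex_pairs n. f e} i) / (real n * p) - 1\<bar> > \<theta>} \<subseteq>
    (\<lambda>f. degree_of {e \<in> vertex_pairs n. f e} i) -` {x. \<bar>real x / real (n - 1) - p\<bar> \<ge> c}"
  proof (intro subsetI vimageI2 CollectI)
    fix f assume f: "f \<in> {f. \<bar>real (degree_of {e \<in> vertex_pairs n. f e} i) / (real n * p) - 1\<bar> > \<theta>}"
    define d where "d = real (degree_of {e \<in> vertex_pairs n. f e} i)"
    show "\<bar>d / real (n - 1) - p\<bar> \<ge> c"
    proof (rule ccontr)
      assume "\<not> \<bar>d / real (n - 1) - p\<bar> \<ge> c"
      then have "\<bar>d / real (n - 1) - p\<bar> * real (n - 1) \<le> c * real (n - 1)" by (intro mult_right_mono) auto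
      moreover have "\<bar>d / real (n - 1) - p\<bar> * real (n - 1) = \<bar>d - real (n - 1) * p\<bar>"
      proof -
        have "(d / N - p) * N = d - N * p" if "N > 0" for N :: real
          using that by (simp add: field_simps)
        then have "(d / real (n - 1) - p) * real (n - 1) = d - real (n - 1) * p" using n by simp
        then show ?thesis by (metis abs_mult abs_of_nat)
      qed
      ultimately have "\<bar>d - real (n - 1) * p\<bar> \<le> c * real (n - 1)" by simp
      also have "\<dots> \<le> c * real n" using c by (intro mult_left_mono) auto
      finally have "\<bar>d - real (n - 1) * p\<bar> \<le> c * real n" .
      moreover have "real (n - 1) * p = real n * p - p" using n by (simp add: of_nat_diff algebra_simps)
      moreover have "p \<le> c * real n"
      proof -
        have "c * real n = p * (real n * \<theta>) / 2" by (simp add: c_def)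
        moreover have "p * 2 \<le> p * (real n * \<theta>)" using n(2) p by (intro mult_left_mono) auto
        ultimately show ?thesis by linarith
      qed
      ultimately have "\<bar>d - real n * p\<bar> \<le> 2 * c * real n" using p by linarith
      then have "\<bar>d - real n * p\<bar> \<le> \<theta> * (real n * p)" by (simp add: c_def mult_ac)
      moreover have "d / (real n * p) - 1 = (d - real n * p) / (real n * p)" using n p by (simp add: field_simps)
      ultimately have "\<bar>d / (real n * p) - 1\<bar> \<le> \<theta>" using n p by (simp add: pos_divide_le_eq)
      then show False using f by (simp add: d_def)
    qed
  qed
  then have "measure_pmf.prob (bernoulli_field (vertex_pairs n) p)
      {f. \<bar>real (degree_of {e \<in> vertex_pairs n. f e} i) / (real n * p) - 1\<bar> > \<theta>} \<le>
    measure_pmf.prob (bernoulli_field (vertex_pairs n) p)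
      ((\<lambda>f. degree_of {e \<in> vertex_pairs n. f e} i) -` {x. \<bar>real x / real (n - 1) - p\<bar> \<ge> c})"
    by (rule measure_pmf.finite_measure_mono) simp
  also have "\<dots> = measure_pmf.prob (map_pmf (\<lambda>f. degree_of {e \<in> vertex_pairs n. f e} i) (bernoulli_field (vertex_pairs n) p))
      {x. \<bar>real x / real (n - 1) - p\<bar> \<ge> c}"
    by (simp only: measure_map_pmf)
  also have "map_pmf (\<lambda>f. degree_of {e \<in> vertex_pairs n. f e} i) (bernoulli_field (vertex_pairs n) p) = binomial_pmf (n - 1) p"
    by (rule degree_distribution) (use p i in auto)
  also have "measure_pmf.prob (binomial_pmf (n - 1) p) {x. \<bar>real x / real (n - 1) - p\<bar> \<ge> c}
      \<le> 2 * exp (- 2 * real (n - 1) * c\<^sup>2)"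
    using B.prob_abs_ge'[of c] n c by simp
  also have "- 2 * real (n - 1) * c\<^sup>2 = - (real (n - 1) * (\<theta> * p)\<^sup>2 / 2)"
    by (simp add: c_def power_divide power_mult_distrib)
  finally show ?thesis .
qed

definition degrees_concentrated :: "nat \<Rightarrow> real \<Rightarrow> real \<Rightarrow> nat set set \<Rightarrow> bool" where
  "degrees_concentrated n p \<theta> E \<longleftrightarrow> (\<forall>i\<in>{1..n}. \<bar>real (degree_of E i) / (real n * p) - 1\<bar> \<le> \<theta>)"

lemma degrees_concentrated_whp:
  assumes p: "0 < p" "p < 1" and \<theta>: "0 < \<theta>"
  shows "(\<lambda>n. measure_pmf.prob (bernoulli_field (vertex_pairs n) p)
    {f. \<not> degrees_concentrated n p \<theta> {e \<in> vertex_pairs n. f e}}) \<longlonglongrightarrow> 0"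
proof (rule tendsto_sandwich[OF _ _ tendsto_const])
  define c where "c = (\<theta> * p)\<^sup>2 / 2"
  have c: "c > 0" using p \<theta> by (simp add: c_def)
  show "(\<lambda>n. real n * (2 * exp (- ((real n - 1) * c)))) \<longlonglongrightarrow> 0" using c by real_asymp
  have "\<forall>\<^sub>F n in sequentially. real n \<ge> 2 / \<theta>"
    by (intro eventually_compose_filterlim[OF eventually_ge_at_top] filterlim_real_sequentially)
  moreover have "\<forall>\<^sub>F n in sequentially. n > (1::nat)" by (rule eventually_gt_at_top)
  ultimately show "\<forall>\<^sub>F n in sequentially. measure_pmf.prob (bernoulli_field (vertex_pairs n) p)
    {f. \<not> degrees_concentrated n p \<theta> {e \<in> vertex_pairs n. f e}} \<le> real n * (2 * exp (- ((real n - 1) * c)))"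
  proof eventually_elim
    case (elim n)
    have n: "real n * \<theta> \<ge> 2" using elim(1) \<theta> by (simp add: pos_divide_le_eq)
    let ?B = "\<lambda>i. {f. \<bar>real (degree_of {e \<in> vertex_pairs n. f e} i) / (real n * p) - 1\<bar> > \<theta>}"
    have "{f. \<not> degrees_concentrated n p \<theta> {e \<in> vertex_pairs n. f e}} = (\<Union>i\<in>{1..n}. ?B i)"
      by (auto simp: degrees_concentrated_def not_le)
    then have "measure_pmf.prob (bernoulli_field (vertex_pairs n) p) {f. \<not> degrees_concentrated n p \<theta> {e \<in> vertex_pairs n. f e}}
        \<le> (\<Sum>i\<in>{1..n}. measure_pmf.prob (bernoulli_field (vertex_pairs n) p) (?B i))"
      by (simp only:) (rule measure_pmf.finite_measure_subadditive_finite, auto)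
    also have "\<dots> \<le> (\<Sum>i\<in>{1..n}. 2 * exp (- (real (n - 1) * (\<theta> * p)\<^sup>2 / 2)))"
      by (intro sum_mono degree_deviation[OF p \<theta> elim(2) n])
    also have "\<dots> = real n * (2 * exp (- ((real n - 1) * c)))" using elim(2) by (simp add: c_def of_nat_diff)
    finally show ?case .
  qed
qed simp_all

section \<open>Comparison of the Randic matrix with the centred adjacency matrix\<close>

lemma powr_product_near_one:
  assumes "\<delta> > 0"
  obtains \<theta> where "0 < \<theta>" "\<And>x y :: real. \<bar>x - 1\<bar> \<le> \<theta> \<Longrightarrow> \<bar>y - 1\<bar> \<le> \<theta> \<Longrightarrow> \<bar>(x * y) powr \<alpha> - 1\<bar> \<le> \<delta>"
proof -
  have "isCont (\<lambda>x::real. x powr \<alpha>) 1" by (intro continuous_intros) auto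
  then obtain r where r: "r > 0" "\<And>x. \<bar>x - 1\<bar> < r \<Longrightarrow> \<bar>x powr \<alpha> - 1\<bar> < \<delta>"
    using assms by (fastforce simp: continuous_at_eps_delta dist_real_def)
  define \<theta> where "\<theta> = min 1 (r / 4)"
  have \<theta>: "0 < \<theta>" "\<theta> \<le> 1" "3 * \<theta> < r" using r by (auto simp: \<theta>_def)
  show thesis
  proof (rule that[OF \<theta>(1)])
    fix x y :: real assume xy: "\<bar>x - 1\<bar> \<le> \<theta>" "\<bar>y - 1\<bar> \<le> \<theta>"
    have "x * y - 1 = (x - 1) * (y - 1) + (x - 1) + (y - 1)" by (simp add: algebra_simps)
    moreover have "\<bar>(x - 1) * (y - 1)\<bar> \<le> \<theta> * 1"
      unfolding abs_mult using xy \<theta> by (intro mult_mono) auto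
    ultimately have "\<bar>x * y - 1\<bar> \<le> 3 * \<theta>" using xy by linarith
    then show "\<bar>(x * y) powr \<alpha> - 1\<bar> \<le> \<delta>" using r(2)[of "x * y"] \<theta>(3) by linarith
  qed
qed

lemma eigen_basis_scale:
  assumes "eigen_basis n H l u" shows "eigen_basis n (\<lambda>i j. s * H i j) (\<lambda>k. s * l k) u"
  using assms by (simp add: eigen_basis_def sum_distrib_left mult_ac)

text \<open>Off the diagonal, the entry of the Randic matrix is \<open>c (x_i x_j) powr \<alpha>\<close> on edges, where \<open>x_i\<close> is the degree
divided by \<open>n p\<close>, and \<open>0\<close> elsewhere. So it differs from \<open>c sqrt n\<close> times the entry of the centred matrix by
the constant \<open>c p\<close>, up to an error \<open>\<delta> c\<close>. The constant comes from centring the edge indicators.\<close>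

lemma energy_randic_approx:
  fixes f :: "nat set \<Rightarrow> bool"
  assumes p: "0 < p" "p < 1" and n: "n > 0" and \<delta>: "\<delta> > 0"
    and deg: "degrees_concentrated n p \<theta> {e \<in> vertex_pairs n. f e}"
    and \<theta>: "\<And>x y :: real. \<bar>x - 1\<bar> \<le> \<theta> \<Longrightarrow> \<bar>y - 1\<bar> \<le> \<theta> \<Longrightarrow> \<bar>(x * y) powr \<alpha> - 1\<bar> \<le> \<delta>"
  defines "c \<equiv> (real n * p) powr (2 * \<alpha>)"
  shows "\<bar>energy (randic_matrix \<alpha> n {e \<in> vertex_pairs n. f e}) / (c * (real n * sqrt (real n)))
    - (\<Sum>k<n. \<bar>eigenvalues n (wigner n p f) k\<bar>) / real n\<bar> \<le> 2 * p / sqrt (real n) + \<delta>"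
proof -
  define E where "E = {e \<in> vertex_pairs n. f e}"
  define R where "R i j = (if {Suc i, Suc j} \<in> E
     then (real (degree_of E (Suc i)) * real (degree_of E (Suc j))) powr \<alpha> else 0)" for i j
  define B where "B i j = c * sqrt (real n) * wigner n p f i j" for i j
  have np: "real n * p > 0" using p n by simp
  have c: "c > 0" using p n by (simp add: c_def)
  have s: "sqrt (real n) > 0" using n by simp
  have eb: "eigen_basis n (wigner n p f) (eigenvalues n (wigner n p f)) (eigenvectors n (wigner n p f))"
    by (rule eigen_basis_some) (rule wigner_commute)
  have eB: "energy (mat n n (\<lambda>(i, j). B i j)) = c * sqrt (real n) * (\<Sum>k<n. \<bar>eigenvalues n (wigner n p f) k\<bar>)"
    unfolding B_def energy_eq_sum_abs_eigenvalues[OF eigen_basis_scale[OF eb]]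
    using c by (simp add: abs_mult sum_distrib_left)
  have diag: "R i i = B i i" for i by (simp add: R_def B_def E_def vertex_pairs_def wigner_def)
  have off: "\<bar>R i j - B i j - c * p\<bar> \<le> \<delta> * c" if ij: "i < n" "j < n" "i \<noteq> j" for i j
  proof -
    have B: "B i j = c * (of_bool (f {Suc i, Suc j}) - p)"
      using ij s by (simp add: B_def wigner_def)
    show ?thesis
    proof (cases "f {Suc i, Suc j}")
      case False
      then show ?thesis using \<delta> c by (simp add: R_def E_def B algebra_simps)
    next
      case True
      define x where "x k = real (degree_of E (Suc k)) / (real n * p)" for k
      have x: "\<bar>x k - 1\<bar> \<le> \<theta>" if "k < n" for k
        using deg that by (simp add: degrees_concentrated_def x_def E_def)
      have "R i j = ((real n * p) * (real n * p) * (x i * x j)) powr \<alpha>"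
        using True mem_vertex_pairs[OF ij] p n by (simp add: R_def E_def x_def)
      also have "\<dots> = c * (x i * x j) powr \<alpha>"
      proof -
        have "(y * y) powr \<alpha> = y powr (2 * \<alpha>)" if "y > 0" for y :: real
          using that by (simp add: powr_mult flip: powr_add)
        moreover have "0 \<le> x i * x j" using p by (simp add: x_def)
        ultimately show ?thesis using np by (subst powr_mult) (auto simp: c_def)
      qed
      finally have "R i j - B i j - c * p = c * ((x i * x j) powr \<alpha> - 1)"
        using True by (simp add: B algebra_simps)
      then have "\<bar>R i j - B i j - c * p\<bar> = c * \<bar>(x i * x j) powr \<alpha> - 1\<bar>" using c by (simp add: abs_mult)
      also have "\<dots> \<le> c * \<delta>" using c x ij by (intro mult_left_mono \<theta>) auto
      finally show ?thesis by (simp add: mult.commute)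
    qed
  qed
  have "\<bar>energy (mat n n (\<lambda>(i, j). R i j)) - energy (mat n n (\<lambda>(i, j). B i j))\<bar>
      \<le> 2 * \<bar>c * p\<bar> * real n + \<delta> * c * (real n * sqrt (real n))"
  proof (rule energy_perturbation)
    show "R i j = R j i" for i j by (simp add: R_def insert_commute mult.commute)
    show "B i j = B j i" for i j unfolding B_def by (subst wigner_commute) (rule refl)
    show "0 \<le> \<delta> * c" using \<delta> c by simp
  qed (use diag off in auto)
  also have "2 * \<bar>c * p\<bar> * real n = 2 * p * (c * real n)" using c p by (simp add: abs_mult)
  finally have main: "\<bar>energy (mat n n (\<lambda>(i, j). R i j)) - c * sqrt (real n) * (\<Sum>k<n. \<bar>eigenvalues n (wigner n p f) k\<bar>)\<bar>
      \<le> 2 * p * (c * real n) + \<delta> * (c * (real n * sqrt (real n)))"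
    by (simp add: eB mult.assoc)
  define C where "C = c * (real n * sqrt (real n))"
  have C: "C > 0" using c n by (simp add: C_def)
  have "(\<Sum>k<n. \<bar>eigenvalues n (wigner n p f) k\<bar>) / real n = c * sqrt (real n) * (\<Sum>k<n. \<bar>eigenvalues n (wigner n p f) k\<bar>) / C"
    using c s n by (simp add: C_def)
  then have "\<bar>energy (mat n n (\<lambda>(i, j). R i j)) / C - (\<Sum>k<n. \<bar>eigenvalues n (wigner n p f) k\<bar>) / real n\<bar>
      = \<bar>energy (mat n n (\<lambda>(i, j). R i j)) - c * sqrt (real n) * (\<Sum>k<n. \<bar>eigenvalues n (wigner n p f) k\<bar>)\<bar> / C"
    using C by (simp flip: diff_divide_distrib)
  also have "\<dots> \<le> (2 * p * (c * real n) + \<delta> * C) / C"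
    using main C by (intro divide_right_mono) (auto simp: C_def)
  also have "\<dots> = 2 * p / sqrt (real n) + \<delta>"
    using C c s n by (simp add: add_divide_distrib) (simp add: C_def)
  moreover have "randic_matrix \<alpha> n E = mat n n (\<lambda>(i, j). R i j)"
    by (simp add: randic_matrix_def R_def)
  ultimately show ?thesis unfolding C_def E_def by simp
qed

theorem corollary7:
  fixes p \<alpha> :: real
  assumes "0 < p" and "p < 1"
  shows "\<forall>\<epsilon>>0. (\<lambda>n. measure_pmf.prob (gnp n p)
    {E. \<bar>energy (randic_matrix \<alpha> n E) /
          (p powr (2 * \<alpha>) * (8 / (3 * pi)) * sqrt (p * (1 - p)) * real n powr (3 / 2 + 2 * \<alpha>))
        - 1\<bar> > \<epsilon>}) \<longlonglongrightarrow> 0"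
proof (intro allI impI)
  fix \<epsilon> :: real assume \<epsilon>: "\<epsilon> > 0"
  note p = assms
  define \<kappa> where "\<kappa> = 8 / (3 * pi) * sqrt (p * (1 - p))"
  have \<kappa>: "\<kappa> > 0" using p by (simp add: \<kappa>_def)
  define \<delta> where "\<delta> = \<epsilon> * \<kappa> / 4"
  have \<delta>: "\<delta> > 0" using \<epsilon> \<kappa> by (simp add: \<delta>_def)
  obtain \<theta> where \<theta>: "0 < \<theta>" "\<And>x y :: real. \<bar>x - 1\<bar> \<le> \<theta> \<Longrightarrow> \<bar>y - 1\<bar> \<le> \<theta> \<Longrightarrow> \<bar>(x * y) powr \<alpha> - 1\<bar> \<le> \<delta>"
    using powr_product_near_one[OF \<delta>, of \<alpha>] by blast
  let ?V = "\<lambda>n. bernoulli_field (vertex_pairs n) p"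
  define X where "X n f = \<bar>(\<Sum>k<n. \<bar>eigenvalues n (wigner n p f) k\<bar>) / real n - \<kappa>\<bar>" for n f
  let ?bad = "\<lambda>n. {f. \<not> degrees_concentrated n p \<theta> {e \<in> vertex_pairs n. f e}}"
  show "(\<lambda>n. measure_pmf.prob (gnp n p)
    {E. \<bar>energy (randic_matrix \<alpha> n E) /
          (p powr (2 * \<alpha>) * (8 / (3 * pi)) * sqrt (p * (1 - p)) * real n powr (3 / 2 + 2 * \<alpha>))
        - 1\<bar> > \<epsilon>}) \<longlonglongrightarrow> 0"
  proof (rule tendsto_sandwich[OF _ _ tendsto_const])
    have "(\<lambda>n. measure_pmf.expectation (?V n) (X n)) \<longlonglongrightarrow> 0"
      using wigner_energy_convergence[OF p] by (simp add: X_def[abs_def] \<kappa>_def)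
    then have "(\<lambda>n. measure_pmf.expectation (?V n) (X n) / (2 * \<delta>)) \<longlonglongrightarrow> 0 / (2 * \<delta>)"
      using \<delta> by (intro tendsto_divide tendsto_const) auto
    then show "(\<lambda>n. measure_pmf.prob (?V n) (?bad n) + measure_pmf.expectation (?V n) (X n) / (2 * \<delta>)) \<longlonglongrightarrow> 0"
      using tendsto_add[OF degrees_concentrated_whp[OF p \<theta>(1)]] by fastforce
    have "(\<lambda>n. 2 * p / sqrt (real n)) \<longlonglongrightarrow> 0" by (rule tendsto_zero_divide_sqrt)
    then have "\<forall>\<^sub>F n in sequentially. 2 * p / sqrt (real n) < \<delta>" using \<delta> by (rule order_tendstoD)
    then show "\<forall>\<^sub>F n in sequentially. measure_pmf.prob (gnp n p)
      {E. \<bar>energy (randic_matrix \<alpha> n E) /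
          (p powr (2 * \<alpha>) * (8 / (3 * pi)) * sqrt (p * (1 - p)) * real n powr (3 / 2 + 2 * \<alpha>))
        - 1\<bar> > \<epsilon>} \<le> measure_pmf.prob (?V n) (?bad n) + measure_pmf.expectation (?V n) (X n) / (2 * \<delta>)"
      using eventually_gt_at_top[of "0::nat"]
    proof eventually_elim
      case (elim n)
      define c where "c = (real n * p) powr (2 * \<alpha>)"
      have c: "c > 0" using p elim by (simp add: c_def)
      have "real n powr (3 / 2 + 2 * \<alpha>) = real n powr (1 + 1 / 2 + 2 * \<alpha>)" by simp
      also have "\<dots> = real n * sqrt (real n) * real n powr (2 * \<alpha>)"
        unfolding powr_add using elim by (simp add: powr_half_sqrt)
      finally have den: "p powr (2 * \<alpha>) * (8 / (3 * pi)) * sqrt (p * (1 - p)) * real n powr (3 / 2 + 2 * \<alpha>)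
          = c * (real n * sqrt (real n)) * \<kappa>"
        using p by (simp add: c_def \<kappa>_def powr_mult)
      let ?bad' = "{f. X n f \<ge> 2 * \<delta>}"
      let ?en = "\<lambda>f. energy (randic_matrix \<alpha> n {e \<in> vertex_pairs n. f e})"
      have sub: "{f. \<bar>?en f / (c * (real n * sqrt (real n)) * \<kappa>) - 1\<bar> > \<epsilon>} \<subseteq> ?bad n \<union> ?bad'"
      proof
        fix f assume f: "f \<in> {f. \<bar>?en f / (c * (real n * sqrt (real n)) * \<kappa>) - 1\<bar> > \<epsilon>}"
        show "f \<in> ?bad n \<union> ?bad'"
        proof (rule ccontr)
          assume "f \<notin> ?bad n \<union> ?bad'"
          then have deg: "degrees_concentrated n p \<theta> {e \<in> vertex_pairs n. f e}" and X: "X n f < 2 * \<delta>" by auto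
          define q where "q = ?en f / (c * (real n * sqrt (real n)))"
          \<comment> \<open>Of the allowed \<open>\<epsilon> \<kappa> = 4 \<delta>\<close>, one \<open>\<delta>\<close> is spent on the mean, one on the degrees and two on the Wigner matrix.\<close>
          have "\<bar>q - (\<Sum>k<n. \<bar>eigenvalues n (wigner n p f) k\<bar>) / real n\<bar> \<le> 2 * p / sqrt (real n) + \<delta>"
            unfolding q_def c_def by (rule energy_randic_approx[OF p elim(2) \<delta> deg \<theta>(2)])
          then have "\<bar>q - \<kappa>\<bar> < 4 * \<delta>" using X elim(1) unfolding X_def by linarith
          then have "\<bar>q - \<kappa>\<bar> < \<epsilon> * \<kappa>" by (simp add: \<delta>_def)
          moreover have "q / \<kappa> - 1 = (q - \<kappa>) / \<kappa>" using \<kappa> by (simp add: diff_divide_distrib)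
          ultimately have "\<bar>q / \<kappa> - 1\<bar> < \<epsilon>" using \<kappa> by (simp add: pos_divide_less_eq)
          then show False using f by (simp add: q_def)
        qed
      qed
      have "measure_pmf.prob (gnp n p)
          {E. \<bar>energy (randic_matrix \<alpha> n E) /
          (p powr (2 * \<alpha>) * (8 / (3 * pi)) * sqrt (p * (1 - p)) * real n powr (3 / 2 + 2 * \<alpha>))
          - 1\<bar> > \<epsilon>} = measure_pmf.prob (?V n) {f. \<bar>?en f / (c * (real n * sqrt (real n)) * \<kappa>) - 1\<bar> > \<epsilon>}"
        unfolding gnp_def den by (simp add: vimage_def)
      also have "\<dots> \<le> measure_pmf.prob (?V n) (?bad n \<union> ?bad')"
        by (rule measure_pmf.finite_measure_mono[OF sub]) simp
      also have "\<dots> \<le> measure_pmf.prob (?V n) (?bad n) + measure_pmf.prob (?V n) ?bad'"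
        by (rule measure_Un_le) auto
      also have "measure_pmf.prob (?V n) ?bad' \<le> measure_pmf.expectation (?V n) (X n) / (2 * \<delta>)"
        using integral_Markov_inequality_measure[of "measure_pmf (?V n)" "X n" "{}" "2 * \<delta>"] \<delta>
          integrable_bernoulli_field[of "vertex_pairs n" p "X n", OF finite_vertex_pairs]
        by (simp add: X_def[abs_def])
      finally show ?case by simp
    qed
  qed simp
qed

end
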